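(* Let $d\ge2$ be an integer and let $G=\{g_0,g_1,\dots,g_{d-1}\}$ be a finite Abelian group of order $d$. Consider the group multiplication add urn (GAU) model on $G$ described in the context, with random draw sizes $(M_i)_{i\ge1}$ satisfying Assumptions 1 and 2 of the context, started from a finite number $n_0\ge1$ of balls whose labels generate $G$. For $n\ge0$ and $g\in G$, let $S_{n,g}$ be the number of balls labeled $g$ in the urn after $n$ stages and let $a_{n,g}=S_{n,g}/(n+n_0)$. Then for every $j\in\{0,1,\dots,d-1\}$, $$a_{n,g_j}\to\frac1d\quad\text{almost surely as } n\to\infty .$$
   Context: The GAU model. Let $\ast$ denote the group operation of the finite Abelian group $G$ of order $d$. The urn contains balls labeled by elements of $G$. Initially it contains $S_{0,g}$ balls labeled $g$ for $g\in G$ (deterministic nonnegative integers), with $\sum_{g\in G}S_{0,g}=n_0\ge1$, and the set of labels present, $\{g:S_{0,g}>0\}$, generates $G$. At each stage $i=1,2,\dots$, a random number $M_i$ of balls is drawn one at a time with replacement; if their labels are $X_{i1},\dots,X_{iM_i}$, then one new ball with label $Z_i=X_{i1}\ast X_{i2}\ast\dots\ast X_{iM_i}$ is added to the urn (the drawn balls are all returned). Thus $S_{n,g}=S_{0,g}+\sum_{i=1}^n\mathbf 1\{Z_i=g\}$, and the urn contains $n+n_0$ balls after $n$ stages. Let $\mathcal F_n$ be the $\sigma$-field generated by $\{(X_{i1},\dots,X_{iM_i}):i=1,\dots,n\}$ (so $M_1,\dots,M_n$ are $\mathcal F_n$-measurable). Assumption 1. At each stage $i$, conditionally on $\mathcal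 F_{i-1}$, the draws are independent of $M_i$, and given $M_i=m$ the labels $X_{i1},\dots,X_{im}$ are conditionally independent, each equal to $g\in G$ with probability $S_{i-1,g}/(i-1+n_0)$. That is, for every possible value $m$ of $M_i$ and all $x_1,\dots,x_m\in G$, $$P(M_i=m,X_{i1}=x_1,\dots,X_{im}=x_m\mid\mathcal F_{i-1})=P(M_i=m)\prod_{l=1}^m\frac{S_{i-1,x_l}}{i-1+n_0}.$$ Assumption 2. There are integers $c\ge1$, $C\ge2$ and $2\le m_1<m_2<\dots<m_c\le C$ such that $(M_i)_{i\ge1}$ are i.i.d. with $P(M_i=m_s)=p_s>0$ for $s=1,\dots,c$ and $\sum_{s=1}^c p_s=1$. Moreover there is at least one $s\in\{1,\dots,c\}$ with $\gcd(m_s-1,d)=1$. *)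

theory Defs
  imports "HOL-Probability.Probability" "HOL-Algebra.Algebra"
begin

text \<open>
  The draws of stage \<open>i \<ge> 1\<close> form a list-valued random variable \<open>D i\<close>: in the notation of
  the model, \<open>D i \<omega>\<close> is the tuple \<open>(X\<^sub>i\<^sub>1, \<dots>, X\<^sub>i\<^sub>M)\<close> of drawn labels, and the draw size
  \<open>M\<^sub>i\<close> is its length. \<open>D 0\<close> is never used.
\<close>

definition draw_size :: "(nat \<Rightarrow> 'w \<Rightarrow> 'a list) \<Rightarrow> nat \<Rightarrow> 'w \<Rightarrow> nat" where
  "draw_size D i \<omega> = length (D i \<omega>)"

definition added_label ::
    "('a, 'b) monoid_scheme \<Rightarrow> (nat \<Rightarrow> 'w \<Rightarrow> 'a list) \<Rightarrow> nat \<Rightarrow> 'w \<Rightarrow> 'a" where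
  "added_label G D i \<omega> = (\<Otimes>\<^bsub>G\<^esub>l\<in>{..<draw_size D i \<omega>}. D i \<omega> ! l)"

definition urn_count ::
    "('a, 'b) monoid_scheme \<Rightarrow> ('a \<Rightarrow> nat) \<Rightarrow> (nat \<Rightarrow> 'w \<Rightarrow> 'a list) \<Rightarrow> nat \<Rightarrow> 'a \<Rightarrow> 'w \<Rightarrow> nat"
  where "urn_count G S0 D n g \<omega> = S0 g + card {i \<in> {1..n}. added_label G D i \<omega> = g}"

text \<open>
  An explicit generated \<open>\<sigma>\<close>-algebra is used instead of a supremum of measures, because the
  supremum over the empty family (\<open>n = 0\<close>) would have empty space.
\<close>

definition draw_filtration ::
    "'w measure \<Rightarrow> (nat \<Rightarrow> 'w \<Rightarrow> 'a list) \<Rightarrow> nat \<Rightarrow> 'w measure" where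
  "draw_filtration P D n = sigma (space P) {D i -` A \<inter> space P | i A. i \<in> {1..n}}"

definition draw_rule ::
    "('a, 'b) monoid_scheme \<Rightarrow> 'w measure \<Rightarrow> ('a \<Rightarrow> nat) \<Rightarrow> nat \<Rightarrow> (nat \<Rightarrow> 'w \<Rightarrow> 'a list) \<Rightarrow> bool"
  where
  "draw_rule G P S0 n0 D \<longleftrightarrow>
     (\<forall>i\<ge>1. \<forall>xs\<in>lists (carrier G).
        measure P {\<omega> \<in> space P. draw_size D i \<omega> = length xs} > 0 \<longrightarrow>
        (AE \<omega> in P.
           real_cond_exp P (draw_filtration P D (i - 1))
             (indicator {\<omega>' \<in> space P. D i \<omega>' = xs}) \<omega> =
           measure P {\<omega>' \<in> space P. draw_size D i \<omega>' = length xs} *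
           (\<Prod>l<length xs. real (urn_count G S0 D (i - 1) (xs ! l) \<omega>) / real (i - 1 + n0))))"

end

theory Submission
  imports Defs "HOL-Number_Theory.Cong"
begin

text \<open>
  Let \<open>a\<close> be the vector of label proportions. One stage changes the energy \<open>\<Sum>h. a h\<^sup>2\<close> by \<open>2 / n\<close> times
  \<open>a (Z) - \<Sum>h. a h\<^sup>2\<close> up to \<open>O(1 / n\<^sup>2)\<close>. For a product of \<open>m\<close> independent labels, the expectation of this
  difference is minus half the expectation of \<open>\<Sum>x. (a x - a (x \<otimes> K))\<^sup>2\<close>, where \<open>K\<close> is a product of \<open>m - 1\<close>
  independent labels. Since the energy is bounded, \<open>\<Sum>n. a y ^ (m - 1) * (a x - a (x \<otimes> y ^ (m - 1)))\<^sup>2 / n\<close>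
  is almost surely finite, and because \<open>a\<close> moves by at most \<open>1 / n\<close> the summands without the weight
  \<open>1 / n\<close> tend to 0. If \<open>m - 1\<close> is coprime to the order of \<open>G\<close>, then \<open>a y * (a (x \<otimes> y) - a x)\<close> tends to 0 for all \<open>x\<close>, \<open>y\<close>,
  which forces \<open>a\<close> to converge to the uniform distribution on some subgroup \<open>H\<close>.

  A proper subgroup is impossible: at least one ball lies outside \<open>H\<close> from the beginning, and as long as
  the fraction \<open>u\<close> of such balls is small, the next ball is outside with probability at least \<open>3/2 * u\<close>.
  A variant of \<open>1 / u\<close> is then a nonnegative supermartingale, which by Fatou's lemma cannot tend to infinity.
\<close>

section \<open>Almost sure summability and slowly varying sequences\<close>

text \<open>By monotone convergence the integral of the sum is the sum of the integrals. This is
  finite, so the sum itself is finite almost everywhere.\<close>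

lemma AE_summable_of_summable_integral:
  fixes f :: "nat \<Rightarrow> 'w \<Rightarrow> real"
  assumes int: "\<And>n. integrable M (f n)" and nonneg: "\<And>n x. x \<in> space M \<Longrightarrow> 0 \<le> f n x"
    and summ: "summable (\<lambda>n. integral\<^sup>L M (f n))"
  shows "AE x in M. summable (\<lambda>n. f n x)"
proof -
  have [measurable]: "\<And>n. f n \<in> borel_measurable M" using int by blast
  have "(\<integral>\<^sup>+x. suminf (\<lambda>n. ennreal (f n x)) \<partial>M) = suminf (\<lambda>n. \<integral>\<^sup>+x. ennreal (f n x) \<partial>M)"
    by (rule nn_integral_suminf) simp
  also have "\<dots> = suminf (\<lambda>n. ennreal (integral\<^sup>L M (f n)))"
    using int nonneg by (intro suminf_cong nn_integral_eq_integral AE_I2)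
  also have "\<dots> \<noteq> \<infinity>"
    using summ nonneg by (subst suminf_ennreal2) (auto intro!: Bochner_Integration.integral_nonneg_AE)
  finally have "AE x in M. suminf (\<lambda>n. ennreal (f n x)) \<noteq> \<infinity>"
    by (intro nn_integral_noteq_infinite) auto
  then show ?thesis
    using AE_space by eventually_elim (auto intro!: summable_suminf_not_top nonneg)
qed

lemma summable_inverse_squares: "summable (\<lambda>n. 1 / real (Suc n) ^ 2)"
  using inverse_power_summable[of 2, where 'a = real]
  by (subst summable_Suc_iff) (simp add: inverse_eq_divide)

text \<open>The increments of \<open>f\<^sup>2\<close> are summable, so \<open>f\<close> converges.\<close>

lemma slowly_varying_tendsto_0:
  fixes f :: "nat \<Rightarrow> real"
  assumes nonneg: "\<And>n. 0 \<le> f n"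
    and slow: "\<And>n. \<bar>f (Suc n) - f n\<bar> \<le> K / real (Suc n)"
    and summ: "summable (\<lambda>n. f n / real (Suc n))"
  shows "f \<longlonglongrightarrow> 0"
proof -
  have K: "0 \<le> K" using slow[of 0] by simp
  \<comment> \<open>The increment of the square factors as difference times sum, and
    \<open>f (Suc n)\<close> is at most \<open>f n + K / Suc n\<close>. Of the two resulting terms,
    one is summable by hypothesis and the other by comparison with inverse squares.\<close>
  have bd: "norm ((f (Suc n))\<^sup>2 - (f n)\<^sup>2) \<le> 2 * K * (f n / real (Suc n)) + K\<^sup>2 * (1 / (real (Suc n))^2)" for n
  proof -
    have "norm ((f (Suc n))\<^sup>2 - (f n)\<^sup>2) = \<bar>f (Suc n) - f n\<bar> * (f (Suc n) + f n)"
      using nonneg[of n] nonneg[of "Suc n"] by (simp add: power2_eq_square square_diff_square_factored abs_mult)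
    also have "\<dots> \<le> (K / real (Suc n)) * (2 * f n + K / real (Suc n))"
      using slow[of n] nonneg[of n] nonneg[of "Suc n"] K by (intro mult_mono) (auto simp del: of_nat_Suc)
    also have "\<dots> = 2 * K * (f n / real (Suc n)) + K\<^sup>2 * (1 / (real (Suc n))^2)"
      by (simp add: power2_eq_square field_simps del: of_nat_Suc)
    finally show ?thesis .
  qed
  have "summable (\<lambda>n. 2 * K * (f n / real (Suc n)) + K\<^sup>2 * (1 / (real (Suc n))^2))"
    by (intro summable_add summable_mult summ summable_inverse_squares)
  then have "summable (\<lambda>n. (f (Suc n))\<^sup>2 - (f n)\<^sup>2)"
    by (rule summable_comparison_test'[OF _ bd])
  then have "convergent (\<lambda>n. (f n)\<^sup>2 - (f 0)\<^sup>2)"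
    using sum_lessThan_telescope[of "\<lambda>n. (f n)\<^sup>2"] by (simp add: summable_iff_convergent)
  then have "convergent (\<lambda>n. (f n)\<^sup>2)"
    by (simp add: convergent_diff_const_right_iff)
  then obtain L where L: "(\<lambda>n. (f n)\<^sup>2) \<longlonglongrightarrow> L" unfolding convergent_def by blast
  have L0: "0 \<le> L" by (rule LIMSEQ_le_const[OF L]) simp
  have fL: "f \<longlonglongrightarrow> sqrt L"
    using tendsto_real_sqrt[OF L] nonneg by simp
  \<comment> \<open>With a positive limit, \<open>f n / Suc n\<close> would eventually dominate a
    multiple of the harmonic series.\<close>
  have "L = 0"
  proof (rule ccontr)
    assume "L \<noteq> 0"
    then have "sqrt L / 2 < sqrt L" "0 < sqrt L" using L0 by auto
    then have "\<forall>\<^sub>F n in sequentially. sqrt L / 2 < f n"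
      using order_tendstoD(1)[OF fL] by blast
    then have "\<forall>\<^sub>F n in sequentially. norm (inverse (real (Suc n))) \<le> f n / real (Suc n) * (2 / sqrt L)"
    proof eventually_elim
      case (elim n)
      then have "1 \<le> f n * (2 / sqrt L)" using \<open>0 < sqrt L\<close> by (simp add: field_simps)
      then show ?case by (simp add: field_simps del: of_nat_Suc)
    qed
    then have "summable (\<lambda>n. inverse (real (Suc n)))"
      by (rule summable_comparison_test_ev) (intro summable_mult2 summ)
    then show False
      using not_summable_harmonic[where 'a = real] by (subst (asm) summable_Suc_iff) (simp add: inverse_eq_divide)
  qed
  then show ?thesis using fL by simp
qed

text \<open>Boundedness is included so that the class is closed under products, hence contains every
  polynomial in the shares.\<close>

definition slow_bounded :: "(nat \<Rightarrow> real) \<Rightarrow> bool" where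
  "slow_bounded f \<longleftrightarrow> (\<exists>B. \<forall>n. \<bar>f n\<bar> \<le> B) \<and> (\<exists>K. \<forall>n. \<bar>f (Suc n) - f n\<bar> \<le> K / real (Suc n))"

lemma slow_bounded_diff:
  assumes "slow_bounded f" "slow_bounded g"
  shows "slow_bounded (\<lambda>n. f n - g n)"
proof -
  obtain B K B' K' where *: "\<And>n. \<bar>f n\<bar> \<le> B" "\<And>n. \<bar>f (Suc n) - f n\<bar> \<le> K / real (Suc n)"
    "\<And>n. \<bar>g n\<bar> \<le> B'" "\<And>n. \<bar>g (Suc n) - g n\<bar> \<le> K' / real (Suc n)"
    using assms unfolding slow_bounded_def by blast
  have "\<bar>f n - g n\<bar> \<le> B + B'" for n using *(1,3)[of n] by linarith
  moreover have "\<bar>(f (Suc n) - g (Suc n)) - (f n - g n)\<bar> \<le> (K + K') / real (Suc n)" for n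
    using *(2,4)[of n] unfolding add_divide_distrib by linarith
  ultimately show ?thesis unfolding slow_bounded_def by blast
qed

lemma slow_bounded_mult:
  assumes "slow_bounded f" "slow_bounded g"
  shows "slow_bounded (\<lambda>n. f n * g n)"
proof -
  obtain B K B' K' where *: "\<And>n. \<bar>f n\<bar> \<le> B" "\<And>n. \<bar>f (Suc n) - f n\<bar> \<le> K / real (Suc n)"
    "\<And>n. \<bar>g n\<bar> \<le> B'" "\<And>n. \<bar>g (Suc n) - g n\<bar> \<le> K' / real (Suc n)"
    using assms unfolding slow_bounded_def by blast
  have pos: "0 \<le> B" "0 \<le> B'" using *(1,3)[of 0] by linarith+
  have "\<bar>f n * g n\<bar> \<le> B * B'" for n
    unfolding abs_mult using * pos by (intro mult_mono) auto
  moreover have "\<bar>f (Suc n) * g (Suc n) - f n * g n\<bar> \<le> (K * B' + B * K') / real (Suc n)" for n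
  proof -
    have "f (Suc n) * g (Suc n) - f n * g n = (f (Suc n) - f n) * g (Suc n) + f n * (g (Suc n) - g n)"
      by (simp add: algebra_simps)
    also have "\<bar>\<dots>\<bar> \<le> \<bar>f (Suc n) - f n\<bar> * \<bar>g (Suc n)\<bar> + \<bar>f n\<bar> * \<bar>g (Suc n) - g n\<bar>"
      using abs_triangle_ineq by (simp flip: abs_mult)
    also have "\<dots> \<le> K / real (Suc n) * B' + B * (K' / real (Suc n))"
      using * pos order_trans[OF abs_ge_zero *(2)[of n]] by (intro add_mono mult_mono) auto
    finally show ?thesis by (simp add: add_divide_distrib)
  qed
  ultimately show ?thesis unfolding slow_bounded_def by blast
qed

lemma slow_bounded_power:
  assumes "slow_bounded f"
  shows "slow_bounded (\<lambda>n. f n ^ k)"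
proof (induction k)
  case 0
  have "\<forall>n. \<bar>f n ^ 0\<bar> \<le> 1" "\<forall>n. \<bar>f (Suc n) ^ 0 - f n ^ 0\<bar> \<le> 0 / real (Suc n)" by auto
  then show ?case unfolding slow_bounded_def by blast
next
  case (Suc k)
  then show ?case using slow_bounded_mult[OF assms] by simp
qed

subsection \<open>Products of independent random group elements\<close>

definition tuples :: "('a, 'b) monoid_scheme \<Rightarrow> nat \<Rightarrow> 'a list set" where
  "tuples G m = {xs \<in> lists (carrier G). length xs = m}"

definition list_prod :: "('a, 'b) monoid_scheme \<Rightarrow> 'a list \<Rightarrow> 'a" where
  "list_prod G xs = (\<Otimes>\<^bsub>G\<^esub>l\<in>{..<length xs}. xs ! l)"

text \<open>Expectation of \<open>f\<close> at the product of \<open>m\<close> independent labels with distribution \<open>v\<close>.\<close>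

definition tuple_mean :: "('a, 'b) monoid_scheme \<Rightarrow> ('a \<Rightarrow> real) \<Rightarrow> nat \<Rightarrow> ('a \<Rightarrow> real) \<Rightarrow> real" where
  "tuple_mean G v m f = (\<Sum>xs\<in>tuples G m. (\<Prod>l<length xs. v (xs ! l)) * f (list_prod G xs))"

lemma finite_tuples: "finite (carrier G) \<Longrightarrow> finite (tuples G m)"
  using finite_lists_length_eq[of "carrier G" m] by (simp add: tuples_def lists_eq_set conj_commute)

lemma tuples_0: "tuples G 0 = {[]}"
  by (auto simp: tuples_def)

lemma tuples_Suc: "tuples G (Suc m) = (\<lambda>(y, ys). y # ys) ` (carrier G \<times> tuples G m)"
  by (auto simp: tuples_def image_iff length_Suc_conv)

context comm_group
begin

lemma list_prod_Nil: "list_prod G [] = \<one>"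
  by (simp add: list_prod_def)

lemma list_prod_Cons:
  assumes "y \<in> carrier G" "ys \<in> lists (carrier G)"
  shows "list_prod G (y # ys) = y \<otimes> list_prod G ys"
proof -
  have ys: "ys ! l \<in> carrier G" if "l < length ys" for l
    using assms that by (auto simp: in_lists_conv_set)
  have "list_prod G (y # ys) = (\<Otimes>l\<in>insert 0 (Suc ` {..<length ys}). (y # ys) ! l)"
    by (simp add: list_prod_def lessThan_Suc_eq_insert_0)
  also have "\<dots> = y \<otimes> (\<Otimes>l\<in>Suc ` {..<length ys}. (y # ys) ! l)"
    using assms ys by (subst finprod_insert) auto
  also have "(\<Otimes>l\<in>Suc ` {..<length ys}. (y # ys) ! l) = list_prod G ys"
    unfolding list_prod_def using ys by (subst finprod_reindex) (auto intro!: finprod_cong')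
  finally show ?thesis .
qed

lemma list_prod_closed: "xs \<in> lists (carrier G) \<Longrightarrow> list_prod G xs \<in> carrier G"
  by (auto simp: list_prod_def in_lists_conv_set intro!: finprod_closed)

lemma tuple_mean_0: "tuple_mean G v 0 f = f \<one>"
  by (simp add: tuple_mean_def tuples_0 list_prod_Nil)

lemma tuple_mean_Suc:
  "tuple_mean G v (Suc m) f = (\<Sum>y\<in>carrier G. v y * tuple_mean G v m (\<lambda>k. f (y \<otimes> k)))"
proof -
  have inj: "inj_on (\<lambda>(y, ys). y # ys) (carrier G \<times> tuples G m)"
    by (auto simp: inj_on_def)
  show ?thesis
    unfolding tuple_mean_def tuples_Suc sum.reindex[OF inj] sum_distrib_left sum.cartesian_product
    by (intro sum.cong)
      (auto simp: list_prod_Cons tuples_def prod.lessThan_Suc_shift in_lists_conv_set mult.assoc simp del: prod.lessThan_Suc)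
qed

lemma tuple_mean_cong:
  assumes "\<And>k. k \<in> carrier G \<Longrightarrow> f k = f' k"
  shows "tuple_mean G v m f = tuple_mean G v m f'"
  unfolding tuple_mean_def using assms
  by (intro sum.cong) (auto simp: tuples_def list_prod_closed)

lemma tuple_mean_mono:
  assumes "\<And>k. k \<in> carrier G \<Longrightarrow> 0 \<le> v k" "\<And>k. k \<in> carrier G \<Longrightarrow> f k \<le> f' k"
  shows "tuple_mean G v m f \<le> tuple_mean G v m f'"
  unfolding tuple_mean_def using assms
  by (intro sum_mono mult_left_mono prod_nonneg)
    (auto simp: tuples_def list_prod_closed in_lists_conv_set)

lemma tuple_mean_linear:
  "tuple_mean G v m (\<lambda>k. c * f k + c' * f' k) = c * tuple_mean G v m f + c' * tuple_mean G v m f'"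
  by (simp add: tuple_mean_def sum_distrib_left sum.distrib algebra_simps)

lemma tuple_mean_sum:
  "(\<Sum>y\<in>A. c y * tuple_mean G v m (f y)) = tuple_mean G v m (\<lambda>k. \<Sum>y\<in>A. c y * f y k)"
  unfolding tuple_mean_def sum_distrib_left by (subst sum.swap) (simp add: mult_ac)

lemma tuple_mean_const:
  assumes "(\<Sum>k\<in>carrier G. v k) = 1"
  shows "tuple_mean G v m (\<lambda>_. b) = b"
  using assms by (induction m) (simp_all add: tuple_mean_0 tuple_mean_Suc flip: sum_distrib_right)

text \<open>The constant list \<open>y, ..., y\<close> has weight \<open>v y ^ m\<close> and product
  \<open>y [^] m\<close>; all other lists contribute nonnegative terms. The induction keeps only the
  summand \<open>y\<close> of each factor.\<close>

lemma tuple_mean_ge_power: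
  assumes "finite (carrier G)" "\<And>k. k \<in> carrier G \<Longrightarrow> 0 \<le> v k" "\<And>k. k \<in> carrier G \<Longrightarrow> 0 \<le> f k" "y \<in> carrier G"
  shows "v y ^ m * f (y [^] m) \<le> tuple_mean G v m f"
  using assms(3)
proof (induction m arbitrary: f)
  case 0
  then show ?case by (simp add: tuple_mean_0)
next
  case (Suc m)
  have "v y ^ Suc m * f (y [^] Suc m) = v y * (v y ^ m * f (y \<otimes> y [^] m))"
    using nat_pow_Suc2[OF assms(4), of m] by (simp del: nat_pow_Suc)
  also have "\<dots> \<le> v y * tuple_mean G v m (\<lambda>k. f (y \<otimes> k))"
    using assms Suc by (intro mult_left_mono Suc.IH) auto
  also have "\<dots> \<le> (\<Sum>y\<in>carrier G. v y * tuple_mean G v m (\<lambda>k. f (y \<otimes> k)))"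
  proof (rule member_le_sum)
    fix z assume z: "z \<in> carrier G - {y}"
    have "tuple_mean G v m (\<lambda>_. 0) \<le> tuple_mean G v m (\<lambda>k. f (z \<otimes> k))"
      using z assms Suc.prems by (intro tuple_mean_mono) auto
    then show "0 \<le> v z * tuple_mean G v m (\<lambda>k. f (z \<otimes> k))"
      using z assms by (simp add: tuple_mean_def)
  qed (use assms in auto)
  also have "\<dots> = tuple_mean G v (Suc m) f" by (simp add: tuple_mean_Suc)
  finally show ?case .
qed

lemma sum_translate:
  assumes "k \<in> carrier G"
  shows "(\<Sum>y\<in>carrier G. f (y \<otimes> k)) = (\<Sum>y\<in>carrier G. f y)"
  using assms
  by (intro sum.reindex_bij_witness[of _ "\<lambda>y. y \<otimes> inv k" "\<lambda>y. y \<otimes> k"]) (auto simp: m_assoc)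

text \<open>Fix the product \<open>k\<close> of the last \<open>m\<close> labels and average over
  the first label \<open>y\<close>. This gives the inner product of \<open>v\<close> with its
  translate by \<open>k\<close>. Translation preserves the sum of squares, so by polarization the
  inner product is that sum minus half the squared distance between \<open>v\<close> and the
  translate.\<close>

lemma tuple_mean_self:
  assumes "(\<Sum>k\<in>carrier G. v k) = 1"
  shows "tuple_mean G v (Suc m) v =
    (\<Sum>y\<in>carrier G. (v y)\<^sup>2) - tuple_mean G v m (\<lambda>k. \<Sum>y\<in>carrier G. (v y - v (y \<otimes> k))\<^sup>2) / 2"
proof -
  let ?R = "\<Sum>y\<in>carrier G. (v y)\<^sup>2" and ?D = "\<lambda>k. \<Sum>y\<in>carrier G. (v y - v (y \<otimes> k))\<^sup>2"
  have *: "(\<Sum>y\<in>carrier G. v y * v (y \<otimes> k)) = 1 * ?R + (-1/2) * ?D k" if "k \<in> carrier G" for k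
  proof -
    have "?D k = ?R + (\<Sum>y\<in>carrier G. (v (y \<otimes> k))\<^sup>2) - 2 * (\<Sum>y\<in>carrier G. v y * v (y \<otimes> k))"
      by (simp add: power2_diff sum.distrib sum_subtractf sum_distrib_left mult.assoc)
    also have "(\<Sum>y\<in>carrier G. (v (y \<otimes> k))\<^sup>2) = ?R"
      using sum_translate[OF that, of "\<lambda>y. (v y)\<^sup>2"] .
    finally show ?thesis by (simp add: field_simps)
  qed
  have "tuple_mean G v (Suc m) v = tuple_mean G v m (\<lambda>k. \<Sum>y\<in>carrier G. v y * v (y \<otimes> k))"
    by (simp add: tuple_mean_Suc tuple_mean_sum)
  also have "\<dots> = tuple_mean G v m (\<lambda>k. 1 * ?R + (-1/2) * ?D k)"
    by (rule tuple_mean_cong[OF *])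
  also have "\<dots> = ?R - tuple_mean G v m ?D / 2"
    unfolding tuple_mean_linear tuple_mean_const[OF assms] by simp
  finally show ?thesis .
qed

text \<open>For small \<open>u\<close>, a product of two labels leaves \<open>H\<close> with
  probability at least \<open>2 * u * (1 - u)\<close>, nearly twice that of a single label. Further
  factors do not destroy this gain: the recursion \<open>step\<close> preserves the lower bound
  \<open>3/2 * u\<close>.\<close>

lemma tuple_mean_outside_subgroup:
  assumes v: "\<And>k. k \<in> carrier G \<Longrightarrow> 0 \<le> v k" "(\<Sum>k\<in>carrier G. v k) = 1"
    and fin: "finite (carrier G)" and H: "subgroup H G"
    and u: "u = (\<Sum>k\<in>carrier G - H. v k)" "u \<le> 1/4" and "2 \<le> m"
  shows "3/2 * u \<le> tuple_mean G v m (indicator (- H))"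
proof -
  let ?t = "\<lambda>m. tuple_mean G v m (indicator (- H))"
  have "H \<subseteq> carrier G" using H by (rule subgroup.subset)
  have uH: "(\<Sum>k\<in>H. v k) = 1 - u"
    using sum.subset_diff[OF \<open>H \<subseteq> carrier G\<close> fin, of v] v u by simp
  have u0: "0 \<le> u" unfolding u by (rule sum_nonneg) (use v in auto)
  \<comment> \<open>a product of two factors leaves \<open>H\<close> when exactly one of them lies outside\<close>
  have step: "u + (1 - 2 * u) * ?t m \<le> ?t (Suc m)" for m
  proof -
    have eq: "tuple_mean G v m (\<lambda>k. indicator (- H) (y \<otimes> k)) = ?t m" if "y \<in> H" for y
    proof (rule tuple_mean_cong)
      fix k assume k: "k \<in> carrier G"
      have "k \<in> H" if "y \<otimes> k \<in> H"
      proof -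
        have "inv y \<otimes> (y \<otimes> k) \<in> H"
          using H that \<open>y \<in> H\<close> by (simp add: subgroup.m_closed subgroup.m_inv_closed)
        then show ?thesis
          using k \<open>y \<in> H\<close> \<open>H \<subseteq> carrier G\<close> by (auto simp flip: m_assoc simp: subset_iff)
      qed
      then show "indicator (- H) (y \<otimes> k) = (indicator (- H) k :: real)"
        using subgroup.m_closed[OF H \<open>y \<in> H\<close>] by (auto simp: indicator_def)
    qed
    \<comment> \<open>Only an inequality: if both \<open>y\<close> and \<open>k\<close> lie outside
      \<open>H\<close>, their product may fall on either side.\<close>
    have le: "1 - ?t m \<le> tuple_mean G v m (\<lambda>k. indicator (- H) (y \<otimes> k))" if "y \<in> carrier G - H" for y
    proof -
      have "1 - ?t m = tuple_mean G v m (\<lambda>k. 1 * 1 + (-1) * indicator (- H) k)"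
        unfolding tuple_mean_linear tuple_mean_const[OF v(2)] by simp
      also have "\<dots> \<le> tuple_mean G v m (\<lambda>k. indicator (- H) (y \<otimes> k))"
      proof (rule tuple_mean_mono)
        fix k assume "k \<in> carrier G"
        have "y \<otimes> k \<notin> H" if "k \<in> H"
        proof
          assume "y \<otimes> k \<in> H"
          then have "(y \<otimes> k) \<otimes> inv k \<in> H" using H that by (simp add: subgroup.m_closed subgroup.m_inv_closed)
          then show False using \<open>y \<in> carrier G - H\<close> \<open>k \<in> carrier G\<close> by (simp add: m_assoc)
        qed
        then show "1 * 1 + (-1) * indicator (- H) k \<le> (indicator (- H) (y \<otimes> k) :: real)"
          by (auto simp: indicator_def)
      qed (use v in auto)
      finally show ?thesis .
    qed
    have "u + (1 - 2 * u) * ?t m = (\<Sum>y\<in>H. v y) * ?t m + u * (1 - ?t m)"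
      unfolding uH by (simp add: algebra_simps)
    also have "\<dots> = (\<Sum>y\<in>H. v y * ?t m) + (\<Sum>y\<in>carrier G - H. v y * (1 - ?t m))"
      by (simp add: u sum_distrib_right)
    also have "\<dots> \<le> (\<Sum>y\<in>H. v y * tuple_mean G v m (\<lambda>k. indicator (- H) (y \<otimes> k)))
        + (\<Sum>y\<in>carrier G - H. v y * tuple_mean G v m (\<lambda>k. indicator (- H) (y \<otimes> k)))"
      using v le \<open>H \<subseteq> carrier G\<close> by (intro add_mono sum_mono mult_left_mono) (auto simp: eq)
    also have "\<dots> = ?t (Suc m)"
      unfolding tuple_mean_Suc by (subst sum.subset_diff[OF \<open>H \<subseteq> carrier G\<close> fin]) simp
    finally show ?thesis .
  qed
  show ?thesis using \<open>2 \<le> m\<close>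
  proof (induction m rule: nat_induct_at_least)
    case base
    \<comment> \<open>The empty product is \<open>\<one>\<close>, which lies in \<open>H\<close>, so
      \<open>?t 0 = 0\<close>.\<close>
    have "u \<le> ?t 1"
      using step[of 0] subgroup.one_closed[OF H] by (simp add: tuple_mean_0)
    then have "u + (1 - 2 * u) * u \<le> u + (1 - 2 * u) * ?t 1"
      using u by (intro add_left_mono mult_left_mono) auto
    also have "\<dots> \<le> ?t 2" using step[of 1] by (simp add: numeral_2_eq_2)
    finally have "2 * u - 2 * (u * u) \<le> ?t 2" by (simp add: algebra_simps)
    \<comment> \<open>For positive \<open>u\<close>, \<open>2 * u - 2 * u * u\<close> is at least
      \<open>3/2 * u\<close> exactly when \<open>u\<close> is at most 1/4. This is the origin of the
      threshold.\<close>
    moreover have "u * u \<le> 1/4 * u" using u u0 by (intro mult_right_mono)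
    ultimately show ?case by simp
  next
    case (Suc m)
    have "u + (1 - 2 * u) * (3/2 * u) \<le> u + (1 - 2 * u) * ?t m"
      using u Suc by (intro add_left_mono mult_left_mono) auto
    also have "\<dots> \<le> ?t (Suc m)" by (rule step)
    finally have "5/2 * u - 3 * (u * u) \<le> ?t (Suc m)" by (simp add: field_simps)
    moreover have "u * u \<le> 1/4 * u" using u u0 by (intro mult_right_mono)
    ultimately show ?case using u0 by linarith
  qed
qed

section \<open>Dichotomy for the limit of the shares\<close>

text \<open>
  By slow variation every share eventually stays near 0 or near the share of \<open>\<one>\<close>; the labels of the
  second kind form the subgroup.
\<close>

lemma uniform_or_concentrated_on_subgroup:
  fixes a :: "nat \<Rightarrow> 'a \<Rightarrow> real"
  assumes fin: "finite (carrier G)"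
    and nonneg: "\<And>n h. 0 \<le> a n h" and sum1: "\<And>n. (\<Sum>h\<in>carrier G. a n h) = 1"
    and step: "\<And>h. h \<in> carrier G \<Longrightarrow> (\<lambda>n. a (Suc n) h - a n h) \<longlonglongrightarrow> 0"
    and trans: "\<And>x y. x \<in> carrier G \<Longrightarrow> y \<in> carrier G \<Longrightarrow> (\<lambda>n. a n y * (a n (x \<otimes> y) - a n x)) \<longlonglongrightarrow> 0"
  shows "(\<forall>h\<in>carrier G. (\<lambda>n. a n h) \<longlonglongrightarrow> 1 / real (order G)) \<or>
    (\<exists>H. subgroup H G \<and> H \<noteq> carrier G \<and> (\<lambda>n. \<Sum>h\<in>carrier G - H. a n h) \<longlonglongrightarrow> 0)"
proof -
  \<comment> \<open>The average share, which the largest share always reaches.\<close>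
  define \<delta> where "\<delta> = 1 / real (order G)"
  have \<delta>: "\<delta> > 0" using fin order_gt_0_iff_finite by (simp add: \<delta>_def)
  have self: "(\<lambda>n. a n h * (a n h - a n \<one>)) \<longlonglongrightarrow> 0" if "h \<in> carrier G" for h
    using trans[of \<one> h] that by simp
  \<comment> \<open>The bound \<open>\<delta>^2 / 32\<close> lies below
    \<open>\<delta>^2 / 4\<close>, used in \<open>one\<close>, and below
    \<open>\<delta>^2 / 16\<close>, used in \<open>gap\<close>. The bound
    \<open>\<delta> / 4\<close> on the steps below is the width of the band from
    \<open>\<delta> / 4\<close> to \<open>\<delta> / 2\<close>, so no share can jump across that
    band.\<close>
  have "\<forall>\<^sub>F n in sequentially. \<bar>a n h * (a n h - a n \<one>)\<bar> < \<delta>\<^sup>2 / 32" if "h \<in> carrier G" for h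
    using order_tendstoD(2)[OF tendsto_rabs_zero[OF self[OF that]], of "\<delta>\<^sup>2 / 32"] \<delta> by simp
  moreover have "\<forall>\<^sub>F n in sequentially. \<bar>a (Suc n) h - a n h\<bar> < \<delta> / 4" if "h \<in> carrier G" for h
    using order_tendstoD(2)[OF tendsto_rabs_zero[OF step[OF that]], of "\<delta> / 4"] \<delta> by simp
  ultimately have "\<forall>\<^sub>F n in sequentially. \<forall>h\<in>carrier G.
      \<bar>a n h * (a n h - a n \<one>)\<bar> < \<delta>\<^sup>2 / 32 \<and> \<bar>a (Suc n) h - a n h\<bar> < \<delta> / 4"
    using fin by (intro eventually_ball_finite) (auto intro: eventually_conj)
  then obtain n1 where n1:
    "\<And>n h. n1 \<le> n \<Longrightarrow> h \<in> carrier G \<Longrightarrow> \<bar>a n h * (a n h - a n \<one>)\<bar> < \<delta>\<^sup>2 / 32"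
    "\<And>n h. n1 \<le> n \<Longrightarrow> h \<in> carrier G \<Longrightarrow> \<bar>a (Suc n) h - a n h\<bar> < \<delta> / 4"
    unfolding eventually_sequentially by blast
  have one: "3/4 * \<delta> \<le> a n \<one>" if "n1 \<le> n" for n
  proof -
    have "\<exists>h\<in>carrier G. \<delta> \<le> a n h"
    proof (rule ccontr)
      assume "\<not> ?thesis"
      then have "(\<Sum>h\<in>carrier G. a n h) < (\<Sum>h\<in>carrier G. \<delta>)"
        using fin by (intro sum_strict_mono) auto
      then show False using \<delta> by (simp add: sum1 \<delta>_def order_def split: if_splits)
    qed
    then obtain h where h: "h \<in> carrier G" "\<delta> \<le> a n h" by blast
    show ?thesis
    proof (rule ccontr)
      assume "\<not> ?thesis"
      then have "\<delta> * (\<delta> / 4) \<le> a n h * (a n h - a n \<one>)"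
        using h \<delta> by (intro mult_mono) auto
      then show False using n1(1)[OF that h(1)] \<delta> by (simp add: power2_eq_square)
    qed
  qed
  \<comment> \<open>Inside the band both \<open>a n h\<close> and \<open>a n \<one> - a n h\<close>
    are at least \<open>\<delta> / 4\<close>, which contradicts the smallness of their
    product.\<close>
  have gap: "a n h < \<delta> / 4 \<or> \<delta> / 2 < a n h" if "n1 \<le> n" "h \<in> carrier G" for n h
  proof (rule ccontr)
    assume "\<not> ?thesis"
    then have "\<delta> / 4 * (\<delta> / 4) \<le> a n h * (a n \<one> - a n h)"
      using one[OF that(1)] \<delta> by (intro mult_mono) auto
    also have "\<dots> = - (a n h * (a n h - a n \<one>))" by (simp add: algebra_simps)
    finally have "\<delta>\<^sup>2 / 16 \<le> - (a n h * (a n h - a n \<one>))" by (simp add: power2_eq_square)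
    moreover have "0 < \<delta>\<^sup>2" using \<delta> by simp
    ultimately show False using n1(1)[OF that] by linarith
  qed
  \<comment> \<open>The labels above the band at time \<open>n1\<close>. Shares neither enter the
    band nor jump across it, so each label stays on its side forever.\<close>
  define B where "B = {h \<in> carrier G. \<delta> / 2 < a n1 h}"
  have B: "\<delta> / 2 < a n h" if "h \<in> B" "n1 \<le> n" for n h
    using that(2)
  proof (induction n rule: dec_induct)
    case (step n)
    have "h \<in> carrier G" using that by (simp add: B_def)
    then show ?case using gap[of "Suc n" h] n1(2)[of n h] step by linarith
  qed (use that in \<open>simp add: B_def\<close>)
  have notB: "a n h < \<delta> / 4" if "h \<in> carrier G - B" "n1 \<le> n" for n h
    using that(2)
  proof (induction n rule: dec_induct)
    case base
    then show ?case using gap[of n1 h] that by (auto simp: B_def)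
  next
    case (step n)
    then show ?case using gap[of "Suc n" h] n1(2)[of n h] that by (simp; linarith)
  qed
  \<comment> \<open>Shares on different sides of the band differ by more than
    \<open>\<delta> / 4\<close>, so they cannot become asymptotically equal.\<close>
  have close: "h' \<in> B" if "h \<in> B" "h' \<in> carrier G" "(\<lambda>n. a n h' - a n h) \<longlonglongrightarrow> 0" for h h'
  proof (rule ccontr)
    assume "h' \<notin> B"
    have "\<forall>\<^sub>F n in sequentially. - (\<delta> / 4) < a n h' - a n h"
      using order_tendstoD(1)[OF that(3), of "- (\<delta> / 4)"] \<delta> by simp
    then obtain n where "n1 \<le> n" "- (\<delta> / 4) < a n h' - a n h"
      unfolding eventually_sequentially by (metis nle_le)
    then show False using B[OF that(1)] notB[of h'] that(2) \<open>h' \<notin> B\<close> by fastforce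
  qed
  have BG: "B \<subseteq> carrier G" by (auto simp: B_def)
  \<comment> \<open>For \<open>y\<close> in \<open>B\<close> the factor \<open>a n y\<close> exceeds
    \<open>\<delta> / 2\<close>, so it can be divided out of \<open>trans\<close>.\<close>
  have transB: "(\<lambda>n. a n (x \<otimes> y) - a n x) \<longlonglongrightarrow> 0" if "x \<in> carrier G" "y \<in> B" for x y
  proof (rule tendsto_0_le[OF trans[OF that(1)]])
    show "y \<in> carrier G" using that BG by blast
    show "\<forall>\<^sub>F n in sequentially. norm (a n (x \<otimes> y) - a n x) \<le> norm (a n y * (a n (x \<otimes> y) - a n x)) * (2 / \<delta>)"
      unfolding eventually_sequentially
    proof (intro exI allI impI)
      fix n assume "n1 \<le> n"
      then have "1 \<le> a n y * (2 / \<delta>)" using B[OF that(2) \<open>n1 \<le> n\<close>] \<delta> by (simp add: field_simps)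
      then have "\<bar>a n (x \<otimes> y) - a n x\<bar> * 1 \<le> \<bar>a n (x \<otimes> y) - a n x\<bar> * (a n y * (2 / \<delta>))"
        by (intro mult_left_mono) auto
      then show "norm (a n (x \<otimes> y) - a n x) \<le> norm (a n y * (a n (x \<otimes> y) - a n x)) * (2 / \<delta>)"
        using nonneg by (simp add: abs_mult mult_ac)
    qed
  qed
  have oneB: "\<one> \<in> B" using one[of n1] \<delta> by (simp add: B_def)
  have "subgroup B G"
  proof (rule subgroupI)
    fix y assume y: "y \<in> B"
    then have "(\<lambda>n. a n \<one> - a n (inv y)) \<longlonglongrightarrow> 0" using transB[of "inv y" y] BG by auto
    then have "(\<lambda>n. a n (inv y) - a n \<one>) \<longlonglongrightarrow> 0" using tendsto_minus by fastforce
    then show "inv y \<in> B" using close[OF oneB] y BG by auto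
    fix x assume "x \<in> B"
    then show "x \<otimes> y \<in> B"
      using close[OF \<open>x \<in> B\<close> m_closed transB[OF _ y]] y BG by blast
  qed (use BG oneB in auto)
  show ?thesis
  proof (cases "B = carrier G")
    case True
    then have diff: "(\<lambda>n. a n h - a n \<one>) \<longlonglongrightarrow> 0" if "h \<in> carrier G" for h
      using transB[of \<one> h] that by simp
    \<comment> \<open>The shares sum to 1, so the share of \<open>\<one>\<close> is the average
      share minus the mean deviation from it.\<close>
    have "a n \<one> = \<delta> * (1 - (\<Sum>h\<in>carrier G. a n h - a n \<one>))" for n
      using \<delta> by (simp add: sum_subtractf sum1 \<delta>_def order_def)
    moreover have "(\<lambda>n. \<delta> * (1 - (\<Sum>h\<in>carrier G. a n h - a n \<one>))) \<longlonglongrightarrow> \<delta> * (1 - (\<Sum>h\<in>carrier G. 0))"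
      by (intro tendsto_intros diff)
    ultimately have "(\<lambda>n. a n \<one>) \<longlonglongrightarrow> \<delta>" by simp
    then have "(\<lambda>n. a n h) \<longlonglongrightarrow> \<delta>" if "h \<in> carrier G" for h
      using tendsto_add[OF diff[OF that]] by fastforce
    then show ?thesis by (simp add: \<delta>_def)
  next
    case False
    \<comment> \<open>Off \<open>B\<close> the distance of \<open>a n h\<close> to
      \<open>a n \<one>\<close> is at least \<open>\<delta> / 2\<close>, so in \<open>self\<close>
      the factor \<open>a n h\<close> must vanish.\<close>
    have "(\<lambda>n. a n h) \<longlonglongrightarrow> 0" if h: "h \<in> carrier G - B" for h
    proof (rule tendsto_0_le[OF self])
      show "h \<in> carrier G" using h by blast
      show "\<forall>\<^sub>F n in sequentially. norm (a n h) \<le> norm (a n h * (a n h - a n \<one>)) * (2 / \<delta>)"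
        unfolding eventually_sequentially
      proof (intro exI allI impI)
        fix n assume n: "n1 \<le> n"
        then have "1 \<le> \<bar>a n h - a n \<one>\<bar> * (2 / \<delta>)"
          using notB[OF h n] one[OF n] \<delta> by (simp add: field_simps)
        then have "a n h * 1 \<le> a n h * (\<bar>a n h - a n \<one>\<bar> * (2 / \<delta>))"
          using nonneg by (intro mult_left_mono) auto
        then show "norm (a n h) \<le> norm (a n h * (a n h - a n \<one>)) * (2 / \<delta>)"
          using nonneg by (simp add: abs_mult mult_ac)
      qed
    qed
    then have "(\<lambda>n. \<Sum>h\<in>carrier G - B. a n h) \<longlonglongrightarrow> 0" by (rule tendsto_null_sum)
    then show ?thesis using \<open>subgroup B G\<close> False by blast
  qed
qed

end

text \<open>Here \<open>N\<close> is the number of balls, \<open>x + 1/2\<close> the number outside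
  \<open>H\<close>, and \<open>q\<close> the probability that the next ball falls outside. From
  \<open>x \<ge> 1/2\<close> follows \<open>3/2 * (x + 1/2) \<ge> x + 1\<close>, so
  \<open>q \<ge> (x + 1) / N\<close>. The expected decrease through a larger denominator is then at
  least \<open>1 / x\<close>, which is the increase caused by the growth of
  \<open>N\<close>.\<close>

lemma potential_drift:
  fixes N x q :: real
  assumes "1 \<le> N" "1/2 \<le> x" "3/2 * ((x + 1/2) / N) \<le> q"
  shows "(N + 1) / x + ((N + 1) / (x + 1) - (N + 1) / x) * q \<le> N / x"
proof -
  have "(x + 1) / N \<le> 3/2 * (x + 1/2) / N" using assms by (intro divide_right_mono) auto
  then have q: "(x + 1) / N \<le> q" using assms(3) unfolding times_divide_eq_right by linarith
  have "(N + 1) / (x * (x + 1)) = (N + 1) / x - (N + 1) / (x + 1)"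
    using assms by (simp add: field_simps)
  then have eq: "(N + 1) / (x + 1) - (N + 1) / x = - ((N + 1) / (x * (x + 1)))"
    by linarith
  have "1 / x \<le> (N + 1) / N / x" using assms by (intro divide_right_mono) auto
  also have "\<dots> = (N + 1) / (x * (x + 1)) * ((x + 1) / N)"
    using assms by (simp add: divide_simps)
  also have "\<dots> \<le> (N + 1) / (x * (x + 1)) * q" using q assms by (intro mult_left_mono) auto
  finally have "1 / x \<le> (N + 1) / (x * (x + 1)) * q" .
  moreover have "(N + 1) / x = N / x + 1 / x" by (rule add_divide_distrib)
  ultimately show ?thesis unfolding eq mult_minus_left by linarith
qed

subsection \<open>The urn process\<close>

text \<open>The possible draw sizes form a finite set with weights \<open>\<pi>\<close>, so that
  averages over the draw size are sums over this set without an enumeration.\<close>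

locale group_add_urn = comm_group G + prob_space P for G (structure) and P :: "'w measure" +
  fixes D :: "nat \<Rightarrow> 'w \<Rightarrow> 'a list" and S0 :: "'a \<Rightarrow> nat" and n0 :: nat
    and sizes :: "nat set" and \<pi> :: "nat \<Rightarrow> real"
  assumes finite_G: "finite (carrier G)"
    and D_measurable: "\<And>i. i \<ge> 1 \<Longrightarrow> D i \<in> measurable P (count_space (lists (carrier G)))"
    and S0_sum: "(\<Sum>h\<in>carrier G. S0 h) = n0" and n0_pos: "n0 \<ge> 1"
    and S0_generates: "generate G {h \<in> carrier G. S0 h > 0} = carrier G"
    and draw_rule: "draw_rule G P S0 n0 D"
    and finite_sizes: "finite sizes" and sizes_ge2: "\<And>k. k \<in> sizes \<Longrightarrow> 2 \<le> k"
    and size_prob: "\<And>i k. i \<ge> 1 \<Longrightarrow> k \<in> sizes \<Longrightarrow> measure P {\<omega> \<in> space P. draw_size D i \<omega> = k} = \<pi> k"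
    and \<pi>_pos: "\<And>k. k \<in> sizes \<Longrightarrow> \<pi> k > 0" and \<pi>_sum: "(\<Sum>k\<in>sizes. \<pi> k) = 1"
begin

definition share :: "nat \<Rightarrow> 'w \<Rightarrow> 'a \<Rightarrow> real" where
  "share n \<omega> h = real (urn_count G S0 D n h \<omega>) / real (n + n0)"

abbreviation Z :: "nat \<Rightarrow> 'w \<Rightarrow> 'a" where "Z \<equiv> added_label G D"

abbreviation F :: "nat \<Rightarrow> 'w measure" where "F \<equiv> draw_filtration P D"

lemma Z_eq_list_prod: "Z i \<omega> = list_prod G (D i \<omega>)"
  by (simp add: added_label_def list_prod_def draw_size_def)

lemma D_in_lists: "i \<ge> 1 \<Longrightarrow> \<omega> \<in> space P \<Longrightarrow> D i \<omega> \<in> lists (carrier G)"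
  using measurable_space[OF D_measurable] by simp

lemma Z_closed: "i \<ge> 1 \<Longrightarrow> \<omega> \<in> space P \<Longrightarrow> Z i \<omega> \<in> carrier G"
  using D_in_lists by (simp add: Z_eq_list_prod list_prod_closed)

lemma D_vimage: "i \<ge> 1 \<Longrightarrow> D i -` A \<inter> space P \<in> sets P"
proof -
  assume i: "i \<ge> 1"
  have "D i -` A \<inter> space P = D i -` (A \<inter> lists (carrier G)) \<inter> space P"
    using D_in_lists[OF i] by auto
  then show ?thesis using measurable_sets[OF D_measurable[OF i], of "A \<inter> lists (carrier G)"] by simp
qed

lemma space_F [simp]: "space (F n) = space P"
  by (auto simp: draw_filtration_def intro!: space_measure_of)

lemma sets_F: "sets (F n) = sigma_sets (space P) {D i -` A \<inter> space P | i A. i \<in> {1..n}}"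
  unfolding draw_filtration_def by (rule sets_measure_of) auto

lemma subalgebra_F: "Conditional_Expectation.subalgebra P (F n)"
  unfolding Conditional_Expectation.subalgebra_def sets_F by (auto intro!: sets.sigma_sets_subset D_vimage)

lemma measurable_F_imp: "f \<in> borel_measurable (F n) \<Longrightarrow> f \<in> borel_measurable P"
  using measurable_from_subalg[OF subalgebra_F] by blast

lemma measurable_Z_F: "1 \<le> i \<Longrightarrow> i \<le> n \<Longrightarrow> Z i \<in> measurable (F n) (count_space UNIV)"
proof -
  assume i: "1 \<le> i" "i \<le> n"
  have "Z i -` A \<inter> space P \<in> sets (F n)" for A
  proof -
    have "Z i -` A \<inter> space P = D i -` (list_prod G -` A) \<inter> space P"
      by (auto simp: Z_eq_list_prod)
    then show ?thesis unfolding sets_F using i by (intro sigma_sets.Basic) auto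
  qed
  then show ?thesis by (simp add: measurable_def)
qed

lemma urn_count_0: "urn_count G S0 D 0 h \<omega> = S0 h"
  by (simp add: urn_count_def)

lemma urn_count_Suc: "urn_count G S0 D (Suc n) h \<omega> = urn_count G S0 D n h \<omega> + (if Z (Suc n) \<omega> = h then 1 else 0)"
proof -
  have "{i \<in> {1..Suc n}. Z i \<omega> = h} =
    (if Z (Suc n) \<omega> = h then insert (Suc n) {i \<in> {1..n}. Z i \<omega> = h} else {i \<in> {1..n}. Z i \<omega> = h})"
    by (auto simp: le_Suc_eq)
  then show ?thesis by (simp add: urn_count_def)
qed

lemma measurable_urn_count: "k \<le> n \<Longrightarrow> (\<lambda>\<omega>. real (urn_count G S0 D k h \<omega>)) \<in> borel_measurable (F n)"
proof (induction k)
  case (Suc k)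
  have "(\<lambda>\<omega>. if Z (Suc k) \<omega> = h then real 1 else real 0) \<in> borel_measurable (F n)"
    by (rule measurable_compose[OF measurable_Z_F]) (use Suc.prems in auto)
  then show ?case
    unfolding urn_count_Suc of_nat_add if_distrib[of real]
    using Suc by (intro borel_measurable_add) auto
qed (simp add: urn_count_0)

lemma measurable_share: "k \<le> n \<Longrightarrow> (\<lambda>\<omega>. share k \<omega> h) \<in> borel_measurable (F n)"
  unfolding share_def using measurable_urn_count by (intro borel_measurable_divide) auto

lemma sum_urn_count: "\<omega> \<in> space P \<Longrightarrow> (\<Sum>h\<in>carrier G. urn_count G S0 D n h \<omega>) = n + n0"
proof (induction n)
  case (Suc n)
  then show ?case
    using finite_G Z_closed[of "Suc n"] by (simp add: urn_count_Suc sum.distrib)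
qed (simp add: urn_count_0 S0_sum)

lemma share_nonneg: "0 \<le> share n \<omega> h"
  by (simp add: share_def)

lemma sum_share: "\<omega> \<in> space P \<Longrightarrow> (\<Sum>h\<in>carrier G. share n \<omega> h) = 1"
  using sum_urn_count[of \<omega> n] n0_pos by (simp add: share_def flip: sum_divide_distrib of_nat_sum)

lemma share_le_1: "\<omega> \<in> space P \<Longrightarrow> h \<in> carrier G \<Longrightarrow> share n \<omega> h \<le> 1"
  using member_le_sum[of h "carrier G" "share n \<omega>"] share_nonneg finite_G by (simp add: sum_share)

lemma share_Suc: "share (Suc n) \<omega> h = (real (n + n0) * share n \<omega> h + (if Z (Suc n) \<omega> = h then 1 else 0)) / (real (n + n0) + 1)"
  using n0_pos by (simp add: share_def urn_count_Suc add_ac)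

lemma slow_bounded_share:
  assumes "\<omega> \<in> space P" "h \<in> carrier G"
  shows "slow_bounded (\<lambda>n. share n \<omega> h)"
proof -
  have "\<bar>share n \<omega> h\<bar> \<le> 1" for n using assms share_le_1 share_nonneg by simp
  moreover have "\<bar>share (Suc n) \<omega> h - share n \<omega> h\<bar> \<le> 1 / real (Suc n)" for n
  proof -
    have "share (Suc n) \<omega> h - share n \<omega> h = ((if Z (Suc n) \<omega> = h then 1 else 0) - share n \<omega> h) / (real (n + n0) + 1)"
      unfolding share_Suc by (simp add: field_simps)
    also have "\<bar>\<dots>\<bar> \<le> 1 / (real (n + n0) + 1)"
      using share_le_1[OF assms, of n] share_nonneg[of n \<omega> h] by (simp add: divide_right_mono)
    also have "\<dots> \<le> 1 / real (Suc n)" by (intro divide_left_mono) auto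
    finally show ?thesis .
  qed
  ultimately show ?thesis unfolding slow_bounded_def by blast
qed

section \<open>The law of the next ball\<close>

definition draws :: "'a list set" where "draws = (\<Union>k\<in>sizes. tuples G k)"

lemma finite_draws: "finite draws"
  unfolding draws_def using finite_sizes finite_tuples[OF finite_G] by auto

text \<open>The probabilities of the sizes in \<open>sizes\<close> already add up to 1, so almost
  surely no other size occurs.\<close>

lemma D_in_draws_AE:
  assumes "i \<ge> 1"
  shows "AE \<omega> in P. D i \<omega> \<in> draws"
proof -
  have ev: "{\<omega> \<in> space P. draw_size D i \<omega> = k} \<in> sets P" for k
    using D_vimage[OF assms, of "{xs. length xs = k}"] by (simp add: draw_size_def vimage_def Int_def conj_commute)
  have "prob (\<Union>k\<in>sizes. {\<omega> \<in> space P. draw_size D i \<omega> = k}) = (\<Sum>k\<in>sizes. \<pi> k)"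
    using ev finite_sizes assms
    by (subst finite_measure_finite_Union) (auto simp: disjoint_family_on_def size_prob)
  then have "AE \<omega> in P. \<omega> \<in> (\<Union>k\<in>sizes. {\<omega> \<in> space P. draw_size D i \<omega> = k})"
    using ev finite_sizes \<pi>_sum by (subst prob_eq_1[symmetric]) auto
  then show ?thesis
    using AE_space by eventually_elim
      (use D_in_lists[OF assms] in \<open>auto simp: draws_def tuples_def draw_size_def\<close>)
qed

lemma sum_draws:
  "(\<Sum>xs\<in>draws. \<pi> (length xs) * (\<Prod>l<length xs. v (xs ! l)) * f (list_prod G xs)) = (\<Sum>k\<in>sizes. \<pi> k * tuple_mean G v k f)"
proof -
  have "(\<Sum>xs\<in>draws. \<pi> (length xs) * (\<Prod>l<length xs. v (xs ! l)) * f (list_prod G xs))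
      = (\<Sum>k\<in>sizes. \<Sum>xs\<in>tuples G k. \<pi> (length xs) * (\<Prod>l<length xs. v (xs ! l)) * f (list_prod G xs))"
    unfolding draws_def using finite_sizes finite_tuples[OF finite_G]
    by (subst sum.UNION_disjoint) (auto simp: tuples_def)
  then show ?thesis
    unfolding tuple_mean_def sum_distrib_left
    by (auto intro!: sum.cong simp: tuples_def mult.assoc)
qed

text \<open>This turns the draw rule into a one-step averaging formula. Each \<open>Y z\<close>
  depends only on the first \<open>n\<close> stages, so the indicator of a particular draw may be
  replaced by its conditional probability. Summation over the finitely many draws then averages
  \<open>Y\<close> over products of independent labels distributed as the current shares.\<close>

lemma expectation_added_label:
  fixes Y :: "'a \<Rightarrow> 'w \<Rightarrow> real"
  assumes meas: "\<And>z. z \<in> carrier G \<Longrightarrow> Y z \<in> borel_measurable (F n)"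
    and bound: "\<And>z \<omega>. z \<in> carrier G \<Longrightarrow> \<omega> \<in> space P \<Longrightarrow> \<bar>Y z \<omega>\<bar> \<le> B"
  shows "integrable P (\<lambda>\<omega>. \<Sum>k\<in>sizes. \<pi> k * tuple_mean G (share n \<omega>) k (\<lambda>z. Y z \<omega>))"
    and "expectation (\<lambda>\<omega>. Y (Z (Suc n) \<omega>) \<omega>) =
      expectation (\<lambda>\<omega>. \<Sum>k\<in>sizes. \<pi> k * tuple_mean G (share n \<omega>) k (\<lambda>z. Y z \<omega>))"
proof -
  interpret sub: finite_measure_subalgebra P "F n"
    by standard (rule subalgebra_F)
  let ?I = "\<lambda>xs. indicator {\<omega> \<in> space P. D (Suc n) \<omega> = xs} :: 'w \<Rightarrow> real"
  let ?q = "\<lambda>xs \<omega>. \<pi> (length xs) * (\<Prod>l<length xs. share n \<omega> (xs ! l))"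
  have Dxs: "{\<omega> \<in> space P. D (Suc n) \<omega> = xs} \<in> sets P" for xs
    using D_vimage[of "Suc n" "{xs}"] by (simp add: vimage_def Int_def conj_commute)
  have [measurable]: "?I xs \<in> borel_measurable P" for xs
    using Dxs by simp
  have draws: "xs \<in> lists (carrier G)" "length xs \<in> sizes" "list_prod G xs \<in> carrier G" if "xs \<in> draws" for xs
    using that by (auto simp: draws_def tuples_def list_prod_closed)
  have measP: "Y z \<in> borel_measurable P" if "z \<in> carrier G" for z
    using meas[OF that] by (rule measurable_F_imp)
  have int: "integrable P (\<lambda>\<omega>. Y z \<omega> * ?I xs \<omega>)" if "z \<in> carrier G" for z xs
  proof (rule integrable_const_bound[of _ B])
    show "AE \<omega> in P. norm (Y z \<omega> * ?I xs \<omega>) \<le> B"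
      using bound[OF that] by (intro AE_I2) (auto simp: indicator_def intro: order_trans[OF abs_ge_zero])
    show "(\<lambda>\<omega>. Y z \<omega> * ?I xs \<omega>) \<in> borel_measurable P"
      using measP[OF that] by (rule borel_measurable_times) measurable
  qed
  \<comment> \<open>The draw rule for stage \<open>Suc n\<close> conditions on \<open>F n\<close>;
    its premise that the size has positive probability holds for all sizes in
    \<open>sizes\<close>.\<close>
  have rce: "AE \<omega> in P. real_cond_exp P (F n) (?I xs) \<omega> = ?q xs \<omega>" if "xs \<in> draws" for xs
  proof -
    have "measure P {\<omega> \<in> space P. draw_size D (Suc n) \<omega> = length xs} = \<pi> (length xs)"
      using size_prob draws[OF that] by simp
    moreover have "\<pi> (length xs) > 0" using \<pi>_pos draws[OF that] by simp
    ultimately show ?thesis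
      using draw_rule[unfolded draw_rule_def, rule_format, of "Suc n" xs] draws[OF that]
      by (simp add: share_def)
  qed
  have step: "expectation (\<lambda>\<omega>. Y (list_prod G xs) \<omega> * ?I xs \<omega>) = expectation (\<lambda>\<omega>. ?q xs \<omega> * Y (list_prod G xs) \<omega>)"
    and int_q: "integrable P (\<lambda>\<omega>. ?q xs \<omega> * Y (list_prod G xs) \<omega>)" if xs: "xs \<in> draws" for xs
  proof -
    note z = draws(3)[OF xs]
    have q_meas: "?q xs \<in> borel_measurable P"
      using measurable_share[of n n] by (intro measurable_F_imp borel_measurable_times borel_measurable_prod) auto
    have ae: "AE \<omega> in P. Y (list_prod G xs) \<omega> * real_cond_exp P (F n) (?I xs) \<omega> = ?q xs \<omega> * Y (list_prod G xs) \<omega>"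
      using rce[OF xs] by eventually_elim simp
    note intg = sub.real_cond_exp_intg[OF int[OF z] meas[OF z], of xs]
    have "expectation (\<lambda>\<omega>. Y (list_prod G xs) \<omega> * real_cond_exp P (F n) (?I xs) \<omega>)
        = expectation (\<lambda>\<omega>. ?q xs \<omega> * Y (list_prod G xs) \<omega>)"
      using q_meas measP[OF z] by (intro integral_cong_AE ae) (auto intro!: borel_measurable_times)
    then show "expectation (\<lambda>\<omega>. Y (list_prod G xs) \<omega> * ?I xs \<omega>) = expectation (\<lambda>\<omega>. ?q xs \<omega> * Y (list_prod G xs) \<omega>)"
      using intg(2) by simp
    show "integrable P (\<lambda>\<omega>. ?q xs \<omega> * Y (list_prod G xs) \<omega>)"
      using intg(1) q_meas measP[OF z]
      by (subst integrable_cong_AE[OF _ _ ae, symmetric]) (auto intro!: borel_measurable_times)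
  qed
  have eq: "(\<Sum>xs\<in>draws. ?q xs \<omega> * Y (list_prod G xs) \<omega>) =
      (\<Sum>k\<in>sizes. \<pi> k * tuple_mean G (share n \<omega>) k (\<lambda>z. Y z \<omega>))" for \<omega>
    using sum_draws[of "share n \<omega>" "\<lambda>z. Y z \<omega>"] .
  show "integrable P (\<lambda>\<omega>. \<Sum>k\<in>sizes. \<pi> k * tuple_mean G (share n \<omega>) k (\<lambda>z. Y z \<omega>))"
    unfolding eq[symmetric] by (intro Bochner_Integration.integrable_sum int_q)
  \<comment> \<open>Almost surely exactly one indicator in the sum equals 1, that of the actual
    draw.\<close>
  have cases: "AE \<omega> in P. Y (Z (Suc n) \<omega>) \<omega> = (\<Sum>xs\<in>draws. Y (list_prod G xs) \<omega> * ?I xs \<omega>)"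
    using D_in_draws_AE[of "Suc n", simplified] AE_space
  proof eventually_elim
    case (elim \<omega>)
    then have "(\<Sum>xs\<in>draws. Y (list_prod G xs) \<omega> * ?I xs \<omega>) = (\<Sum>xs\<in>draws. if D (Suc n) \<omega> = xs then Y (list_prod G xs) \<omega> else 0)"
      by (intro sum.cong) (auto simp: indicator_def)
    then show ?case using elim finite_draws by (simp add: Z_eq_list_prod)
  qed
  have Z_meas: "(\<lambda>\<omega>. Y (Z (Suc n) \<omega>) \<omega>) \<in> borel_measurable P"
  proof -
    have "(\<lambda>\<omega>. \<Sum>z\<in>carrier G. Y z \<omega> * indicator (Z (Suc n) -` {z} \<inter> space P) \<omega>) \<in> borel_measurable P"
      using measP measurable_sets[OF measurable_Z_F[of "Suc n" "Suc n"]] subalgebra_F[of "Suc n"]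
      by (intro borel_measurable_sum borel_measurable_times borel_measurable_indicator) (auto simp: Conditional_Expectation.subalgebra_def)
    moreover have "(\<Sum>z\<in>carrier G. Y z \<omega> * indicator (Z (Suc n) -` {z} \<inter> space P) \<omega>) = Y (Z (Suc n) \<omega>) \<omega>" if "\<omega> \<in> space P" for \<omega>
    proof -
      have "(\<Sum>z\<in>carrier G. Y z \<omega> * indicator (Z (Suc n) -` {z} \<inter> space P) \<omega>) = (\<Sum>z\<in>carrier G. if Z (Suc n) \<omega> = z then Y z \<omega> else 0)"
        using that by (intro sum.cong) (auto simp: indicator_def)
      then show ?thesis using that finite_G Z_closed[of "Suc n" \<omega>] by simp
    qed
    ultimately show ?thesis by (simp cong: measurable_cong)
  qed
  have "expectation (\<lambda>\<omega>. Y (Z (Suc n) \<omega>) \<omega>) = expectation (\<lambda>\<omega>. \<Sum>xs\<in>draws. Y (list_prod G xs) \<omega> * ?I xs \<omega>)"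
    using Z_meas measP draws by (intro integral_cong_AE cases) (auto intro!: borel_measurable_sum borel_measurable_times)
  also have "\<dots> = (\<Sum>xs\<in>draws. expectation (\<lambda>\<omega>. ?q xs \<omega> * Y (list_prod G xs) \<omega>))"
    using int draws by (simp add: Bochner_Integration.integral_sum step)
  also have "\<dots> = expectation (\<lambda>\<omega>. \<Sum>k\<in>sizes. \<pi> k * tuple_mean G (share n \<omega>) k (\<lambda>z. Y z \<omega>))"
    using int_q unfolding eq[symmetric] by (simp add: Bochner_Integration.integral_sum)
  finally show "expectation (\<lambda>\<omega>. Y (Z (Suc n) \<omega>) \<omega>) =
      expectation (\<lambda>\<omega>. \<Sum>k\<in>sizes. \<pi> k * tuple_mean G (share n \<omega>) k (\<lambda>z. Y z \<omega>))" .
qed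

subsection \<open>Decay of the energy\<close>

definition energy :: "nat \<Rightarrow> 'w \<Rightarrow> real" where
  "energy n \<omega> = (\<Sum>h\<in>carrier G. (share n \<omega> h)\<^sup>2)"

lemma energy_nonneg: "0 \<le> energy n \<omega>"
  by (simp add: energy_def sum_nonneg)

lemma energy_le_1:
  assumes "\<omega> \<in> space P"
  shows "energy n \<omega> \<le> 1"
proof -
  have "energy n \<omega> \<le> (\<Sum>h\<in>carrier G. share n \<omega> h)"
    unfolding energy_def power2_eq_square
    using assms share_nonneg share_le_1 by (intro sum_mono mult_left_le) auto
  then show ?thesis using sum_share[OF assms] by simp
qed

lemma energy_Suc:
  assumes "\<omega> \<in> space P"
  shows "energy (Suc n) \<omega> =
    ((real (n + n0))\<^sup>2 * energy n \<omega> + 2 * real (n + n0) * share n \<omega> (Z (Suc n) \<omega>) + 1) / (real (n + n0) + 1)\<^sup>2"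
proof -
  let ?N = "real (n + n0)" and ?z = "Z (Suc n) \<omega>"
  have "(share (Suc n) \<omega> h)\<^sup>2 = (?N\<^sup>2 * (share n \<omega> h)\<^sup>2 + (if ?z = h then 2 * ?N * share n \<omega> h + 1 else 0)) / (?N + 1)\<^sup>2" for h
    unfolding share_Suc by (simp add: power_divide power2_sum power_mult_distrib)
  then have "energy (Suc n) \<omega> = (?N\<^sup>2 * energy n \<omega> + (\<Sum>h\<in>carrier G. if ?z = h then 2 * ?N * share n \<omega> h + 1 else 0)) / (?N + 1)\<^sup>2"
    by (simp add: energy_def sum.distrib sum_distrib_left flip: sum_divide_distrib)
  then show ?thesis
    using finite_G Z_closed[of "Suc n" \<omega>] assms by simp
qed

lemma measurable_energy: "energy n \<in> borel_measurable (F n)"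
  unfolding energy_def using measurable_share[of n n]
  by (intro borel_measurable_sum borel_measurable_power) auto

lemma integrable_energy: "integrable P (energy n)"
  using energy_nonneg energy_le_1
  by (intro integrable_const_bound[of _ 1] measurable_F_imp[OF measurable_energy]) auto

text \<open>
  The expected loss of energy in one stage dominates the expected asymmetry, which measures how far the
  shares are from being invariant under translation by the \<open>k\<close>-th power of a label \<open>y\<close> that is not rare.
\<close>

definition asymmetry :: "nat \<Rightarrow> 'a \<Rightarrow> 'a \<Rightarrow> nat \<Rightarrow> 'w \<Rightarrow> real" where
  "asymmetry k y x n \<omega> = share n \<omega> y ^ k * (share n \<omega> x - share n \<omega> (x \<otimes> y [^] k))\<^sup>2"

lemma asymmetry_nonneg: "0 \<le> asymmetry k y x n \<omega>"
  by (simp add: asymmetry_def share_nonneg)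

lemma asymmetry_le_1:
  assumes "\<omega> \<in> space P" "y \<in> carrier G" "x \<in> carrier G"
  shows "asymmetry k y x n \<omega> \<le> 1"
proof -
  have "\<bar>share n \<omega> x - share n \<omega> (x \<otimes> y [^] k)\<bar> \<le> 1"
    using share_le_1[OF assms(1), of x n] share_le_1[OF assms(1), of "x \<otimes> y [^] k" n]
      share_nonneg[of n \<omega> x] share_nonneg[of n \<omega> "x \<otimes> y [^] k"] assms by simp
  then have "(share n \<omega> x - share n \<omega> (x \<otimes> y [^] k))\<^sup>2 \<le> 1"
    by (simp add: abs_square_le_1)
  moreover have "share n \<omega> y ^ k \<le> 1"
    using share_nonneg share_le_1 assms by (intro power_le_one) auto
  ultimately show ?thesis
    unfolding asymmetry_def using share_nonneg by (intro mult_le_one) auto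
qed

lemma integrable_asymmetry:
  assumes "y \<in> carrier G" "x \<in> carrier G"
  shows "integrable P (asymmetry k y x n)"
proof -
  have "asymmetry k y x n \<in> borel_measurable P"
    unfolding asymmetry_def using measurable_share[of n n]
    by (intro measurable_F_imp borel_measurable_times borel_measurable_power borel_measurable_diff) auto
  then show ?thesis
    using assms asymmetry_nonneg asymmetry_le_1 by (intro integrable_const_bound[of _ 1]) auto
qed

text \<open>In \<open>tuple_mean_self\<close>, the loss averages a sum of squares over products of
  \<open>k\<close> labels. Keeping only the square at \<open>x\<close> and only the draw of
  \<open>k\<close> copies of \<open>y\<close> leaves the asymmetry.\<close>

lemma tuple_mean_share_le:
  assumes "\<omega> \<in> space P"
  shows "tuple_mean G (share n \<omega>) (Suc k) (share n \<omega>) \<le> energy n \<omega>"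
    and "y \<in> carrier G \<Longrightarrow> x \<in> carrier G \<Longrightarrow>
      tuple_mean G (share n \<omega>) (Suc k) (share n \<omega>) \<le> energy n \<omega> - asymmetry k y x n \<omega> / 2"
proof -
  let ?D = "\<lambda>k. \<Sum>y\<in>carrier G. (share n \<omega> y - share n \<omega> (y \<otimes> k))\<^sup>2"
  have eq: "tuple_mean G (share n \<omega>) (Suc k) (share n \<omega>) = energy n \<omega> - tuple_mean G (share n \<omega>) k ?D / 2"
    unfolding energy_def by (rule tuple_mean_self[OF sum_share[OF assms]])
  have "asymmetry k y x n \<omega> \<le> tuple_mean G (share n \<omega>) k ?D" if "y \<in> carrier G" "x \<in> carrier G" for y x
  proof -
    have "asymmetry k y x n \<omega> \<le> share n \<omega> y ^ k * ?D (y [^] k)"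
      unfolding asymmetry_def using that finite_G share_nonneg
      by (intro mult_left_mono member_le_sum) auto
    also have "\<dots> \<le> tuple_mean G (share n \<omega>) k ?D"
      using that finite_G share_nonneg by (intro tuple_mean_ge_power) (auto intro!: sum_nonneg)
    finally show ?thesis .
  qed
  then show "y \<in> carrier G \<Longrightarrow> x \<in> carrier G \<Longrightarrow>
      tuple_mean G (share n \<omega>) (Suc k) (share n \<omega>) \<le> energy n \<omega> - asymmetry k y x n \<omega> / 2"
    unfolding eq by fastforce
  then show "tuple_mean G (share n \<omega>) (Suc k) (share n \<omega>) \<le> energy n \<omega>"
    using asymmetry_nonneg[of k \<one> \<one> n \<omega>] tuple_mean_mono[of "share n \<omega>" "\<lambda>_. 0" ?D k] share_nonneg
    unfolding eq by (force simp: tuple_mean_def sum_nonneg)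
qed

text \<open>For every draw size the drift is nonpositive up to the term of order
  \<open>1 / n^2\<close> from the square of the new ball itself. The strict loss is retained only
  for the size \<open>Suc k\<close>.\<close>

lemma expectation_energy_Suc_le:
  assumes "Suc k \<in> sizes" "y \<in> carrier G" "x \<in> carrier G"
  shows "expectation (energy (Suc n)) \<le>
    expectation (energy n) + 1 / (real (Suc n))\<^sup>2 - \<pi> (Suc k) / (4 * real n0) * (expectation (asymmetry k y x n) / real (Suc n))"
proof -
  let ?N = "real (n + n0)" and ?A = "asymmetry k y x n"
  \<comment> \<open>The next energy if the added label is \<open>z\<close>, a function of the first
    \<open>n\<close> stages only.\<close>
  define Y where "Y z \<omega> = (?N\<^sup>2 * energy n \<omega> + 2 * ?N * share n \<omega> z + 1) / (?N + 1)\<^sup>2" for z \<omega>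
  let ?W = "\<lambda>\<omega>. \<Sum>k\<in>sizes. \<pi> k * tuple_mean G (share n \<omega>) k (\<lambda>z. Y z \<omega>)"
  let ?c = "\<pi> (Suc k) / (4 * real n0) / real (Suc n)"
  have N: "?N \<ge> 1" using n0_pos by simp
  have Y_meas: "Y z \<in> borel_measurable (F n)" for z
    unfolding Y_def using measurable_energy measurable_share[of n n]
    by (intro borel_measurable_divide borel_measurable_add borel_measurable_times) auto
  have Y_bound: "\<bar>Y z \<omega>\<bar> \<le> 1" if "z \<in> carrier G" "\<omega> \<in> space P" for z \<omega>
  proof -
    have "?N\<^sup>2 * energy n \<omega> + 2 * ?N * share n \<omega> z + 1 \<le> ?N\<^sup>2 * 1 + 2 * ?N * 1 + 1"
      using that energy_le_1 share_le_1 by (intro add_mono mult_left_mono) auto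
    also have "\<dots> = (?N + 1)\<^sup>2" by (simp add: power2_sum)
    finally show ?thesis
      unfolding Y_def using energy_nonneg[of n \<omega>] share_nonneg[of n \<omega> z] by (simp add: abs_divide add_nonneg_nonneg)
  qed
  have W: "?W \<omega> \<le> energy n \<omega> + 1 / (real (Suc n))\<^sup>2 - ?c * ?A \<omega>" if \<omega>: "\<omega> \<in> space P" for \<omega>
  proof -
    let ?r = "energy n \<omega>" and ?v = "share n \<omega>"
    have tm: "tuple_mean G ?v j (\<lambda>z. Y z \<omega>) = (?N\<^sup>2 * ?r + 1) / (?N + 1)\<^sup>2 + 2 * ?N / (?N + 1)\<^sup>2 * tuple_mean G ?v j ?v" for j
    proof -
      have "tuple_mean G ?v j (\<lambda>z. Y z \<omega>) = tuple_mean G ?v j (\<lambda>z. (?N\<^sup>2 * ?r + 1) / (?N + 1)\<^sup>2 * 1 + 2 * ?N / (?N + 1)\<^sup>2 * ?v z)"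
        unfolding Y_def by (rule tuple_mean_cong) (simp add: add_divide_distrib del: of_nat_add)
      then show ?thesis
        unfolding tuple_mean_linear tuple_mean_const[OF sum_share[OF \<omega>]] by simp
    qed
    have "(\<Sum>j\<in>sizes. \<pi> j * tuple_mean G ?v j ?v) \<le> (\<Sum>j\<in>sizes. \<pi> j * ?r - (if j = Suc k then \<pi> j * (?A \<omega> / 2) else 0))"
    proof (rule sum_mono)
      fix j assume j: "j \<in> sizes"
      then obtain i where i: "j = Suc i" using sizes_ge2[OF j] by (cases j) auto
      have "tuple_mean G ?v j ?v \<le> ?r - (if j = Suc k then ?A \<omega> / 2 else 0)"
        using tuple_mean_share_le(1)[OF \<omega>, where n = n and k = i] tuple_mean_share_le(2)[OF \<omega> assms(2,3), where n = n and k = i] i by auto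
      then have "\<pi> j * tuple_mean G ?v j ?v \<le> \<pi> j * (?r - (if j = Suc k then ?A \<omega> / 2 else 0))"
        using \<pi>_pos[OF j] by (intro mult_left_mono) auto
      then show "\<pi> j * tuple_mean G ?v j ?v \<le> \<pi> j * ?r - (if j = Suc k then \<pi> j * (?A \<omega> / 2) else 0)"
        by (auto simp: algebra_simps)
    qed
    also have "\<dots> = ?r - \<pi> (Suc k) * ?A \<omega> / 2"
      using assms(1) finite_sizes by (simp add: sum_subtractf \<pi>_sum flip: sum_distrib_right)
    finally have S: "(\<Sum>j\<in>sizes. \<pi> j * tuple_mean G ?v j ?v) \<le> ?r - \<pi> (Suc k) * ?A \<omega> / 2" .
    have "?W \<omega> = (\<Sum>j\<in>sizes. \<pi> j * ((?N\<^sup>2 * ?r + 1) / (?N + 1)\<^sup>2) + 2 * ?N / (?N + 1)\<^sup>2 * (\<pi> j * tuple_mean G ?v j ?v))"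
      unfolding tm by (intro sum.cong) (simp_all add: algebra_simps)
    also have "\<dots> = (?N\<^sup>2 * ?r + 1) / (?N + 1)\<^sup>2 + 2 * ?N / (?N + 1)\<^sup>2 * (\<Sum>j\<in>sizes. \<pi> j * tuple_mean G ?v j ?v)"
      unfolding sum.distrib sum_distrib_left[symmetric] sum_distrib_right[symmetric] \<pi>_sum by simp
    also have "\<dots> \<le> (?N\<^sup>2 * ?r + 1) / (?N + 1)\<^sup>2 + 2 * ?N / (?N + 1)\<^sup>2 * (?r - \<pi> (Suc k) * ?A \<omega> / 2)"
      using N by (intro add_left_mono mult_left_mono S) auto
    also have "\<dots> = (?N\<^sup>2 + 2 * ?N) / (?N + 1)\<^sup>2 * ?r + 1 / (?N + 1)\<^sup>2 - ?N / (?N + 1)\<^sup>2 * (\<pi> (Suc k) * ?A \<omega>)"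
      by (simp add: add_divide_distrib algebra_simps)
    also have "\<dots> \<le> 1 * ?r + 1 / (real (Suc n))\<^sup>2 - 1 / (4 * real n0 * real (Suc n)) * (\<pi> (Suc k) * ?A \<omega>)"
    proof (intro diff_mono add_mono mult_right_mono)
      show "(?N\<^sup>2 + 2 * ?N) / (?N + 1)\<^sup>2 \<le> 1"
      proof (subst divide_le_eq_1_pos)
        show "0 < (?N + 1)\<^sup>2" using N by (intro zero_less_power) linarith
      qed (simp add: power2_sum)
      show "1 / (?N + 1)\<^sup>2 \<le> 1 / (real (Suc n))\<^sup>2"
        by (intro divide_left_mono power_mono) auto
      \<comment> \<open>Together with \<open>?N + 1 \<le> 2 * ?N\<close> this compares
        \<open>?N / (?N + 1)^2\<close> with \<open>1 / Suc n\<close> and produces the constant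
        \<open>4 * n0\<close>.\<close>
      have "?N \<le> real n0 * real (Suc n)"
      proof -
        have "n + n0 \<le> n0 * Suc n" using n0_pos by simp
        then show ?thesis by (metis of_nat_le_iff of_nat_mult)
      qed
      have "(?N + 1)\<^sup>2 \<le> (2 * ?N)\<^sup>2" using N by (intro power_mono) auto
      also have "\<dots> = 4 * ?N * ?N" by (simp add: power2_eq_square del: of_nat_add)
      also have "\<dots> \<le> 4 * (real n0 * real (Suc n)) * ?N"
        using \<open>?N \<le> real n0 * real (Suc n)\<close> N by (intro mult_right_mono mult_left_mono) auto
      finally have "(?N + 1)\<^sup>2 \<le> ?N * (4 * real n0 * real (Suc n))" by (simp add: mult_ac)
      then show "1 / (4 * real n0 * real (Suc n)) \<le> ?N / (?N + 1)\<^sup>2"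
        using N n0_pos by (simp add: divide_simps del: of_nat_Suc of_nat_add)
    qed (use energy_nonneg asymmetry_nonneg \<pi>_pos[OF assms(1)] in \<open>auto intro: mult_nonneg_nonneg\<close>)
    finally show ?thesis by (simp add: mult_ac)
  qed
  have "expectation (energy (Suc n)) = expectation (\<lambda>\<omega>. Y (Z (Suc n) \<omega>) \<omega>)"
    by (intro Bochner_Integration.integral_cong) (auto simp: energy_Suc Y_def)
  also have "\<dots> = expectation ?W"
    by (rule expectation_added_label(2)[OF Y_meas Y_bound])
  also have "\<dots> \<le> expectation (\<lambda>\<omega>. energy n \<omega> + 1 / (real (Suc n))\<^sup>2 - ?c * ?A \<omega>)"
    using integrable_energy integrable_asymmetry[OF assms(2,3)] W
    by (intro integral_mono expectation_added_label(1)[OF Y_meas Y_bound]) auto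
  also have "\<dots> = expectation (energy n) + 1 / (real (Suc n))\<^sup>2 - ?c * expectation ?A"
    using integrable_energy integrable_asymmetry[OF assms(2,3)] by (simp add: prob_space)
  finally show ?thesis by (simp add: mult_ac)
qed

text \<open>Telescoping the energy inequality bounds the weighted sum of expected asymmetries by the
  initial energy plus the sum of the inverse squares. Hence the weighted series converges almost
  surely, and slow variation removes the weight.\<close>

lemma asymmetry_tendsto_0:
  assumes "Suc k \<in> sizes" "y \<in> carrier G" "x \<in> carrier G"
  shows "AE \<omega> in P. (\<lambda>n. asymmetry k y x n \<omega>) \<longlonglongrightarrow> 0"
proof -
  let ?E = "\<lambda>n. expectation (asymmetry k y x n) / real (Suc n)" and ?c = "\<pi> (Suc k) / (4 * real n0)"
  have c: "0 < ?c" using \<pi>_pos[OF assms(1)] n0_pos by simp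
  have nonneg: "0 \<le> ?E n" for n
    by (simp add: asymmetry_nonneg)
  have partial: "(\<Sum>n<j. ?c * ?E n) \<le> expectation (energy 0) - expectation (energy j) + (\<Sum>n<j. 1 / real (Suc n) ^ 2)" for j
  proof (induction j)
    case (Suc j)
    then show ?case using expectation_energy_Suc_le[OF assms, of j] unfolding sum.lessThan_Suc by linarith
  qed simp
  have squares: "(\<Sum>n<j. 1 / real (Suc n) ^ 2) \<le> suminf (\<lambda>n. 1 / real (Suc n) ^ 2)" for j
    using summable_inverse_squares by (intro sum_le_suminf) auto
  have energy_ge: "0 \<le> expectation (energy j)" for j
    by (simp add: energy_nonneg)
  have "(\<Sum>n<j. ?c * ?E n) \<le> expectation (energy 0) + suminf (\<lambda>n. 1 / real (Suc n) ^ 2)" for j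
    using partial[of j] squares[of j] energy_ge[of j] by linarith
  then have "summable (\<lambda>n. ?c * ?E n)"
    by (rule summableI_nonneg_bounded[OF mult_nonneg_nonneg[OF less_imp_le[OF c] nonneg]])
  then have summ: "summable ?E"
    by (rule summable_mult_D) (use \<pi>_pos[OF assms(1)] n0_pos in auto)
  have "AE \<omega> in P. summable (\<lambda>n. asymmetry k y x n \<omega> / real (Suc n))"
    by (rule AE_summable_of_summable_integral)
      (use summ integrable_asymmetry[OF assms(2,3)] asymmetry_nonneg in auto)
  then show ?thesis
    using AE_space
  proof eventually_elim
    case (elim \<omega>)
    have "slow_bounded (\<lambda>n. asymmetry k y x n \<omega>)"
      unfolding asymmetry_def using elim assms
      by (intro slow_bounded_mult slow_bounded_power slow_bounded_diff slow_bounded_share) auto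
    then obtain K where "\<And>n. \<bar>asymmetry k y x (Suc n) \<omega> - asymmetry k y x n \<omega>\<bar> \<le> K / real (Suc n)"
      unfolding slow_bounded_def by blast
    then show ?case
      using elim asymmetry_nonneg by (intro slowly_varying_tendsto_0) auto
  qed
qed

subsection \<open>Escape from proper subgroups\<close>

definition outside :: "'a set \<Rightarrow> nat \<Rightarrow> 'w \<Rightarrow> real" where
  "outside H n \<omega> = (\<Sum>h\<in>carrier G - H. real (urn_count G S0 D n h \<omega>))"

lemma outside_eq_share: "outside H n \<omega> / real (n + n0) = (\<Sum>h\<in>carrier G - H. share n \<omega> h)"
  by (simp add: outside_def share_def sum_divide_distrib)

lemma outside_Suc:
  assumes "\<omega> \<in> space P"
  shows "outside H (Suc n) \<omega> = outside H n \<omega> + indicator (- H) (Z (Suc n) \<omega>)"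
proof -
  have "outside H (Suc n) \<omega> = outside H n \<omega> + (\<Sum>h\<in>carrier G - H. if Z (Suc n) \<omega> = h then 1 else 0)"
    by (simp add: outside_def urn_count_Suc sum.distrib if_distrib[of real] cong: if_cong)
  then show ?thesis
    using finite_G Z_closed[of "Suc n" \<omega>] assms by (auto simp: indicator_def)
qed

text \<open>The initial labels generate the group, so they cannot all lie in a proper subgroup, and
  no ball is ever removed.\<close>

lemma outside_ge_1:
  assumes "subgroup H G" "H \<noteq> carrier G"
  shows "1 \<le> outside H n \<omega>"
proof -
  have "\<not> {h \<in> carrier G. S0 h > 0} \<subseteq> H"
  proof
    assume "{h \<in> carrier G. S0 h > 0} \<subseteq> H"
    then have "carrier G \<subseteq> H"
      using generate_subgroup_incl[of _ H] S0_generates assms(1) by blast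
    then show False using assms subgroup.subset by blast
  qed
  then obtain h where h: "h \<in> carrier G - H" "S0 h > 0" by blast
  have "1 \<le> real (urn_count G S0 D n h \<omega>)"
    using h by (simp add: urn_count_def)
  also have "\<dots> \<le> outside H n \<omega>"
    unfolding outside_def using h finite_G by (intro member_le_sum) auto
  finally show ?thesis .
qed

lemma measurable_outside: "k \<le> n \<Longrightarrow> outside H k \<in> borel_measurable (F n)"
  unfolding outside_def using measurable_urn_count by (intro borel_measurable_sum) auto

text \<open>
  The reciprocal fraction of balls outside \<open>H\<close>, killed once that fraction exceeds 1/4. Without the shift
  by 1/2 it would not be a supermartingale when a single ball lies outside \<open>H\<close>.
\<close>

definition potential :: "'a set \<Rightarrow> nat \<Rightarrow> nat \<Rightarrow> 'w \<Rightarrow> real" where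
  "potential H n1 n \<omega> =
    (if \<forall>k\<in>{n1..<n}. outside H k \<omega> / real (k + n0) \<le> 1/4 then real (n + n0) / (outside H n \<omega> - 1/2) else 0)"

lemma potential_bounds:
  assumes "subgroup H G" "H \<noteq> carrier G"
  shows "0 \<le> potential H n1 n \<omega>" "potential H n1 n \<omega> \<le> 2 * real (n + n0)"
proof -
  have x: "1/2 \<le> outside H n \<omega> - 1/2" using outside_ge_1[OF assms, of n \<omega>] by simp
  have "real (n + n0) / (outside H n \<omega> - 1/2) \<le> real (n + n0) / (1/2)"
    using x by (intro divide_left_mono) auto
  then show "potential H n1 n \<omega> \<le> 2 * real (n + n0)" by (simp add: potential_def)
  show "0 \<le> potential H n1 n \<omega>" using x by (simp add: potential_def)
qed

lemma measurable_potential: "potential H n1 n \<in> borel_measurable (F n)"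
proof -
  have "{\<omega> \<in> space (F n). \<forall>k\<in>{n1..<n}. outside H k \<omega> / real (k + n0) \<le> 1/4} \<in> sets (F n)"
    using measurable_outside[of _ n H]
    by (intro sets.sets_Collect_finite_All borel_measurable_le borel_measurable_divide) auto
  then show ?thesis
    unfolding potential_def using measurable_outside[of n n H]
    by (intro measurable_If borel_measurable_divide borel_measurable_diff) auto
qed

lemma integrable_potential:
  assumes "subgroup H G" "H \<noteq> carrier G"
  shows "integrable P (potential H n1 n)"
  using potential_bounds[OF assms]
  by (intro integrable_const_bound[of _ "2 * real (n + n0)"] measurable_F_imp[OF measurable_potential]) auto

text \<open>While the outside fraction is at most 1/4, \<open>tuple_mean_outside_subgroup\<close>
  supplies the probability that \<open>potential_drift\<close> requires. After killing, the
  potential stays 0.\<close>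

lemma expectation_potential_Suc_le:
  assumes H: "subgroup H G" "H \<noteq> carrier G" and "n1 \<le> n"
  shows "expectation (potential H n1 (Suc n)) \<le> expectation (potential H n1 n)"
proof -
  let ?N = "real (n + n0)"
  \<comment> \<open>The potential at time \<open>Suc n\<close> tests the fractions only up to time
    \<open>n\<close>. Whether it is killed is therefore known from \<open>F n\<close>, as
    \<open>expectation_added_label\<close> demands.\<close>
  let ?small = "\<lambda>\<omega>. \<forall>k\<in>{n1..<Suc n}. outside H k \<omega> / real (k + n0) \<le> 1/4"
  define Y where "Y z \<omega> = (if ?small \<omega> then (?N + 1) / (outside H n \<omega> + indicator (- H) z - 1/2) else 0)" for z \<omega>
  let ?W = "\<lambda>\<omega>. \<Sum>k\<in>sizes. \<pi> k * tuple_mean G (share n \<omega>) k (\<lambda>z. Y z \<omega>)"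
  have N: "1 \<le> ?N" using n0_pos by simp
  have x: "1/2 \<le> outside H n \<omega> - 1/2" for \<omega> using outside_ge_1[OF H, of n \<omega>] by simp
  have Y_meas: "Y z \<in> borel_measurable (F n)" for z
  proof -
    have "{\<omega> \<in> space (F n). ?small \<omega>} \<in> sets (F n)"
      using measurable_outside[of _ n H]
      by (intro sets.sets_Collect_finite_All borel_measurable_le borel_measurable_divide) auto
    then show ?thesis
      unfolding Y_def using measurable_outside[of n n H]
      by (intro measurable_If borel_measurable_divide borel_measurable_diff borel_measurable_add) auto
  qed
  have Y_bound: "\<bar>Y z \<omega>\<bar> \<le> (?N + 1) / (1/2)" for z \<omega>
  proof -
    have "1/2 \<le> outside H n \<omega> + indicator (- H) z - 1/2" using x[of \<omega>] by (simp add: indicator_def)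
    then have "(?N + 1) / (outside H n \<omega> + indicator (- H) z - 1/2) \<le> (?N + 1) / (1/2)"
      "0 \<le> (?N + 1) / (outside H n \<omega> + indicator (- H) z - 1/2)"
      by (intro divide_left_mono divide_nonneg_nonneg; simp)+
    then show ?thesis by (simp add: Y_def)
  qed
  have W: "?W \<omega> \<le> potential H n1 n \<omega>" if \<omega>: "\<omega> \<in> space P" for \<omega>
  proof (cases "?small \<omega>")
    case False
    have "Y z \<omega> = 0" for z unfolding Y_def using False by (rule if_not_P)
    then have "?W \<omega> = 0" by (simp add: tuple_mean_def)
    then show ?thesis using potential_bounds(1)[OF H] by simp
  next
    case True
    let ?x = "outside H n \<omega> - 1/2" and ?t = "\<lambda>k. tuple_mean G (share n \<omega>) k (indicator (- H))"
    let ?A = "(?N + 1) / ?x" and ?B = "(?N + 1) / (?x + 1) - (?N + 1) / ?x"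
    have tm: "tuple_mean G (share n \<omega>) k (\<lambda>z. Y z \<omega>) = ?A + ?B * ?t k" for k
    proof -
      have "tuple_mean G (share n \<omega>) k (\<lambda>z. Y z \<omega>) = tuple_mean G (share n \<omega>) k (\<lambda>z. ?A * 1 + ?B * indicator (- H) z)"
        using True unfolding Y_def by (intro tuple_mean_cong) (auto simp: indicator_def algebra_simps)
      then show ?thesis
        unfolding tuple_mean_linear tuple_mean_const[OF sum_share[OF \<omega>]] by simp
    qed
    have small: "outside H n \<omega> / ?N \<le> 1/4" using True \<open>n1 \<le> n\<close> by simp
    have "3/2 * (outside H n \<omega> / ?N) \<le> ?t k" if "k \<in> sizes" for k
      by (rule tuple_mean_outside_subgroup[OF share_nonneg sum_share[OF \<omega>] finite_G H(1) outside_eq_share small sizes_ge2[OF that]])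
    then have "(\<Sum>k\<in>sizes. \<pi> k * (3/2 * (outside H n \<omega> / ?N))) \<le> (\<Sum>k\<in>sizes. \<pi> k * ?t k)"
      using \<pi>_pos by (intro sum_mono mult_left_mono) (auto simp: less_imp_le)
    then have q: "3/2 * ((?x + 1/2) / ?N) \<le> (\<Sum>k\<in>sizes. \<pi> k * ?t k)"
      unfolding sum_distrib_right[symmetric] \<pi>_sum by simp
    have "?W \<omega> = (\<Sum>k\<in>sizes. \<pi> k * ?A + ?B * (\<pi> k * ?t k))"
      unfolding tm by (intro sum.cong refl) (simp only: ring_distribs mult_ac)
    also have "\<dots> = ?A + ?B * (\<Sum>k\<in>sizes. \<pi> k * ?t k)"
      unfolding sum.distrib sum_distrib_left[symmetric] sum_distrib_right[symmetric] \<pi>_sum by simp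
    also have "\<dots> \<le> ?N / ?x"
      by (rule potential_drift[OF N x q])
    also have "\<dots> = potential H n1 n \<omega>"
      using True by (simp add: potential_def)
    finally show ?thesis .
  qed
  have "expectation (potential H n1 (Suc n)) = expectation (\<lambda>\<omega>. Y (Z (Suc n) \<omega>) \<omega>)"
    by (intro Bochner_Integration.integral_cong) (auto simp: potential_def Y_def outside_Suc add_ac)
  also have "\<dots> = expectation ?W"
    by (rule expectation_added_label(2)[OF Y_meas Y_bound])
  also have "\<dots> \<le> expectation (potential H n1 n)"
    using integrable_potential[OF H] W by (intro integral_mono expectation_added_label(1)[OF Y_meas Y_bound]) auto
  finally show ?thesis .
qed

text \<open>From time \<open>n1\<close> on the expectations do not increase, so Fatou's lemma bounds
  the integral of the lower limit.\<close>

lemma AE_liminf_potential_finite: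
  assumes H: "subgroup H G" "H \<noteq> carrier G"
  shows "AE \<omega> in P. liminf (\<lambda>n. ennreal (potential H n1 n \<omega>)) \<noteq> \<infinity>"
proof -
  have meas: "(\<lambda>\<omega>. ennreal (potential H n1 n \<omega>)) \<in> borel_measurable P" for n
    using measurable_F_imp[OF measurable_potential[of H n1 n]] by simp
  have "expectation (potential H n1 n) \<le> expectation (potential H n1 n1)" if "n1 \<le> n" for n
    using that by (induction n rule: dec_induct) (auto intro: order_trans[OF expectation_potential_Suc_le[OF H]])
  then have "(\<integral>\<^sup>+\<omega>. ennreal (potential H n1 n \<omega>) \<partial>P) \<le> ennreal (expectation (potential H n1 n1))" if "n1 \<le> n" for n
    using that integrable_potential[OF H] potential_bounds(1)[OF H]
    by (subst nn_integral_eq_integral) (auto intro!: ennreal_leI)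
  then have "liminf (\<lambda>n. \<integral>\<^sup>+\<omega>. ennreal (potential H n1 n \<omega>) \<partial>P) \<le> ennreal (expectation (potential H n1 n1))"
    by (intro Liminf_le) (auto simp: eventually_sequentially)
  then have "(\<integral>\<^sup>+\<omega>. liminf (\<lambda>n. ennreal (potential H n1 n \<omega>)) \<partial>P) \<le> ennreal (expectation (potential H n1 n1))"
    using nn_integral_liminf[of "\<lambda>n \<omega>. ennreal (potential H n1 n \<omega>)" P] meas by (auto intro: order_trans)
  then show ?thesis
    using meas by (intro nn_integral_noteq_infinite) (auto simp: top_unique)
qed

lemma AE_outside_not_tendsto_0:
  assumes H: "subgroup H G" "H \<noteq> carrier G"
  shows "AE \<omega> in P. \<not> (\<lambda>n. \<Sum>h\<in>carrier G - H. share n \<omega> h) \<longlonglongrightarrow> 0"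
proof -
  \<comment> \<open>The time after which the fraction stays below 1/4 depends on the path, so all
    starting times \<open>n1\<close> are treated at once.\<close>
  have "AE \<omega> in P. \<forall>n1. liminf (\<lambda>n. ennreal (potential H n1 n \<omega>)) \<noteq> \<infinity>"
    using AE_liminf_potential_finite[OF H] by (simp add: AE_all_countable)
  then show ?thesis
  proof eventually_elim
    case (elim \<omega>)
    let ?u = "\<lambda>n. outside H n \<omega> / real (n + n0)"
    have pos: "0 < ?u n" for n using outside_ge_1[OF H, of n \<omega>] n0_pos by simp
    show ?case
    proof
      assume "(\<lambda>n. \<Sum>h\<in>carrier G - H. share n \<omega> h) \<longlonglongrightarrow> 0"
      then have u: "?u \<longlonglongrightarrow> 0" by (simp only: outside_eq_share)
      then have "\<forall>\<^sub>F n in sequentially. ?u n < 1/4" by (rule order_tendstoD) simp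
      then obtain n1 where n1: "\<And>n. n1 \<le> n \<Longrightarrow> ?u n \<le> 1/4"
        unfolding eventually_sequentially by (meson less_imp_le)
      \<comment> \<open>From \<open>n1\<close> on the fraction never exceeds 1/4, so the potential
        is never killed and dominates the reciprocal fraction.\<close>
      have le: "inverse (?u n) \<le> potential H n1 n \<omega>" for n
      proof -
        have "real (n + n0) / outside H n \<omega> \<le> real (n + n0) / (outside H n \<omega> - 1/2)"
          using outside_ge_1[OF H, of n \<omega>] by (intro divide_left_mono) auto
        then show ?thesis using n1 by (simp add: potential_def)
      qed
      have "filterlim (\<lambda>n. inverse (?u n)) at_top sequentially"
        using u pos by (intro filterlim_inverse_at_top) auto
      then have "filterlim (\<lambda>n. potential H n1 n \<omega>) at_top sequentially"
        by (rule filterlim_at_top_mono) (use le in auto)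
      then have "liminf (\<lambda>n. ennreal (potential H n1 n \<omega>)) = \<infinity>"
        by (intro lim_imp_Liminf) (auto simp: ennreal_tendsto_top_eq_at_top)
      then show False using elim by blast
    qed
  qed
qed

section \<open>From coprime draw sizes to the uniform limit\<close>

text \<open>As \<open>k\<close> is coprime to the order of the group, \<open>y\<close> is itself a power of \<open>y [^] k\<close>.\<close>

lemma share_translate_tendsto_0:
  assumes \<omega>: "\<omega> \<in> space P" and "coprime k (order G)" and y: "y \<in> carrier G" and x: "x \<in> carrier G"
    and lim: "\<And>x. x \<in> carrier G \<Longrightarrow> (\<lambda>n. asymmetry k y x n \<omega>) \<longlonglongrightarrow> 0"
  shows "(\<lambda>n. share n \<omega> y * (share n \<omega> (x \<otimes> y) - share n \<omega> x)) \<longlonglongrightarrow> 0"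
proof -
  let ?f = "\<lambda>x n. share n \<omega> y * (share n \<omega> (x \<otimes> y [^] k) - share n \<omega> x)"
  have step: "?f x \<longlonglongrightarrow> 0" if x: "x \<in> carrier G" for x
  proof -
    \<comment> \<open>With \<open>a\<close> the share of \<open>y\<close> and \<open>b\<close> the
      absolute difference, the power \<open>k + 2\<close> of \<open>a * b\<close> is the asymmetry
      \<open>a^k * b^2\<close> times \<open>a^2 * b^k\<close>, and the latter is at most 1.\<close>
    have "\<bar>?f x n\<bar> ^ (k + 2) \<le> asymmetry k y x n \<omega>" for n
    proof -
      let ?b = "\<bar>share n \<omega> (x \<otimes> y [^] k) - share n \<omega> x\<bar>" and ?a = "share n \<omega> y"
      have a: "0 \<le> ?a" "?a \<le> 1" using share_nonneg share_le_1 \<omega> y by auto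
      have b: "?b \<le> 1"
        using share_le_1[OF \<omega>, of x n] share_le_1[OF \<omega>, of "x \<otimes> y [^] k" n]
          share_nonneg[of n \<omega> x] share_nonneg[of n \<omega> "x \<otimes> y [^] k"] x y by simp
      have "\<bar>?f x n\<bar> = ?a * ?b" using a by (simp add: abs_mult)
      then have "\<bar>?f x n\<bar> ^ (k + 2) = (?a ^ k * ?b\<^sup>2) * (?a\<^sup>2 * ?b ^ k)"
        by (simp only: power_mult_distrib power_add mult_ac)
      also have "\<dots> \<le> (?a ^ k * ?b\<^sup>2) * 1"
        using a b by (intro mult_left_mono mult_le_one power_le_one) auto
      finally show ?thesis by (simp add: asymmetry_def power2_commute)
    qed
    then have "(\<lambda>n. \<bar>?f x n\<bar> ^ (k + 2)) \<longlonglongrightarrow> 0"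
      by (intro tendsto_sandwich[OF _ _ tendsto_const lim[OF x]]) auto
    then have "(\<lambda>n. root (k + 2) (\<bar>?f x n\<bar> ^ (k + 2))) \<longlonglongrightarrow> root (k + 2) 0"
      by (rule tendsto_real_root)
    then have "(\<lambda>n. \<bar>?f x n\<bar>) \<longlonglongrightarrow> 0"
      by (simp add: real_root_power_cancel del: power_Suc)
    then show ?thesis by (rule tendsto_rabs_zero_cancel)
  qed
  \<comment> \<open>Translation by a power of \<open>y [^] k\<close> telescopes into single
    translations, each covered by \<open>step\<close>.\<close>
  have iter: "(\<lambda>n. share n \<omega> y * (share n \<omega> (x \<otimes> (y [^] k) [^] r) - share n \<omega> x)) \<longlonglongrightarrow> 0" for r :: nat
  proof (induction r)
    case (Suc r)
    have "(\<lambda>n. ?f (x \<otimes> (y [^] k) [^] r) n + share n \<omega> y * (share n \<omega> (x \<otimes> (y [^] k) [^] r) - share n \<omega> x)) \<longlonglongrightarrow> 0"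
      using tendsto_add[OF step Suc] x y by simp
    then show ?case using x y by (simp add: m_assoc algebra_simps)
  qed (use x in simp)
  obtain r where r: "[k * r = 1] (mod order G)"
    using cong_solve_coprime_nat[OF assms(2)] by auto
  have pow_mod: "y [^] (a mod order G) = y [^] a" for a :: nat
  proof -
    have "y [^] a = (y [^] order G) [^] (a div order G) \<otimes> y [^] (a mod order G)"
      using y by (simp add: nat_pow_pow nat_pow_mult)
    then show ?thesis using y by (simp add: pow_order_eq_1)
  qed
  have "(y [^] k) [^] r = y [^] (k * r)" using y by (simp add: nat_pow_pow)
  also have "\<dots> = y [^] (1 :: nat)"
    using pow_mod[of "k * r"] pow_mod[of 1] r by (simp only: cong_def)
  finally have "(y [^] k) [^] r = y" using y by simp
  then show ?thesis using iter[of r] by simp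
qed

text \<open>There are only finitely many subgroups and labels, so the exceptional sets together are
  null. Off them the dichotomy applies path by path, and concentration on a proper subgroup is
  excluded.\<close>

lemma AE_share_tendsto:
  assumes k: "Suc k \<in> sizes" "coprime k (order G)"
  shows "AE \<omega> in P. \<forall>h\<in>carrier G. (\<lambda>n. share n \<omega> h) \<longlonglongrightarrow> 1 / real (order G)"
proof -
  have "finite {H. subgroup H G \<and> H \<noteq> carrier G}"
    by (rule finite_subset[of _ "Pow (carrier G)"]) (use finite_G subgroup.subset in auto)
  then have "AE \<omega> in P. \<forall>H\<in>{H. subgroup H G \<and> H \<noteq> carrier G}. \<not> (\<lambda>n. \<Sum>h\<in>carrier G - H. share n \<omega> h) \<longlonglongrightarrow> 0"
    by (rule AE_finite_allI) (use AE_outside_not_tendsto_0 in auto)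
  moreover have "AE \<omega> in P. \<forall>y\<in>carrier G. \<forall>x\<in>carrier G. (\<lambda>n. asymmetry k y x n \<omega>) \<longlonglongrightarrow> 0"
    by (intro AE_finite_allI finite_G asymmetry_tendsto_0 k)
  ultimately show ?thesis
    using AE_space
  proof eventually_elim
    case (elim \<omega>)
    have "(\<lambda>n. share (Suc n) \<omega> h - share n \<omega> h) \<longlonglongrightarrow> 0" if h: "h \<in> carrier G" for h
    proof -
      obtain K where "\<And>n. \<bar>share (Suc n) \<omega> h - share n \<omega> h\<bar> \<le> K / real (Suc n)"
        using slow_bounded_share[OF elim(3) h] unfolding slow_bounded_def by blast
      then have "\<forall>\<^sub>F n in sequentially. norm (share (Suc n) \<omega> h - share n \<omega> h) \<le> K * inverse (real (Suc n))"
        by (simp add: divide_inverse)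
      moreover have "(\<lambda>n. K * inverse (real (Suc n))) \<longlonglongrightarrow> 0"
        using LIMSEQ_inverse_real_of_nat by (rule tendsto_mult_right_zero)
      ultimately show ?thesis by (rule Lim_null_comparison)
    qed
    then have "(\<forall>h\<in>carrier G. (\<lambda>n. share n \<omega> h) \<longlonglongrightarrow> 1 / real (order G)) \<or>
        (\<exists>H. subgroup H G \<and> H \<noteq> carrier G \<and> (\<lambda>n. \<Sum>h\<in>carrier G - H. share n \<omega> h) \<longlonglongrightarrow> 0)"
      using share_translate_tendsto_0[OF elim(3) k(2)] elim(2)
      by (intro uniform_or_concentrated_on_subgroup finite_G share_nonneg sum_share[OF elim(3)]) auto
    then show ?case using elim(1) by blast
  qed
qed

end

theorem theorem2p4:
  fixes G :: "('a, 'b) monoid_scheme" and d :: nat and g :: "nat \<Rightarrow> 'a"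
    and P :: "'w measure" and D :: "nat \<Rightarrow> 'w \<Rightarrow> 'a list"
    and S0 :: "'a \<Rightarrow> nat" and n0 :: nat
    and c C :: nat and j :: nat and m :: "nat \<Rightarrow> nat" and p :: "nat \<Rightarrow> real"
  assumes "comm_group G" and "finite (carrier G)" and "order G = d" and "d \<ge> 2"
    and "bij_betw g {..<d} (carrier G)"
    and "prob_space P"
    and "\<And>i. i \<ge> 1 \<Longrightarrow> D i \<in> measurable P (count_space (lists (carrier G)))"
    and "(\<Sum>h\<in>carrier G. S0 h) = n0" and "n0 \<ge> 1"
    and "generate G {h \<in> carrier G. S0 h > 0} = carrier G"
    and assumption1: "draw_rule G P S0 n0 D"
    and assumption2:
      "c \<ge> 1" "C \<ge> 2" "strict_mono_on {1..c} m" "\<And>s. s \<in> {1..c} \<Longrightarrow> 2 \<le> m s \<and> m s \<le> C"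
      "prob_space.indep_vars P (\<lambda>_. count_space UNIV) (draw_size D) {1..}"
      "\<And>i s. i \<ge> 1 \<Longrightarrow> s \<in> {1..c} \<Longrightarrow>
         measure P {\<omega> \<in> space P. draw_size D i \<omega> = m s} = p s"
      "\<And>s. s \<in> {1..c} \<Longrightarrow> p s > 0" "(\<Sum>s\<in>{1..c}. p s) = 1"
      "\<exists>s\<in>{1..c}. gcd (m s - 1) d = 1"
    and "j < d"
  shows "AE \<omega> in P.
    (\<lambda>n. real (urn_count G S0 D n (g j) \<omega>) / real (n + n0)) \<longlonglongrightarrow> 1 / real d"
proof -
  interpret G: comm_group G by fact
  interpret P: prob_space P by fact
  \<comment> \<open>As \<open>m\<close> is injective, the weights \<open>p\<close> can be carried
    over to the sizes themselves.\<close>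
  let ?sizes = "m ` {1..c}" and ?\<pi> = "\<lambda>k. p (the_inv_into {1..c} m k)"
  have inj: "inj_on m {1..c}" using assumption2(3) by (rule strict_mono_on_imp_inj_on)
  have \<pi>: "?\<pi> (m s) = p s" if "s \<in> {1..c}" for s
    using the_inv_into_f_f[OF inj that] by simp
  interpret urn: group_add_urn G P D S0 n0 ?sizes ?\<pi>
  proof
    have "(\<Sum>k\<in>?sizes. ?\<pi> k) = (\<Sum>s\<in>{1..c}. p s)"
      unfolding sum.reindex[OF inj] o_def by (intro sum.cong refl \<pi>)
    then show "(\<Sum>k\<in>?sizes. ?\<pi> k) = 1"
      using assumption2(8) by (rule trans)
    show "measure P {\<omega> \<in> space P. draw_size D i \<omega> = k} = ?\<pi> k" if "1 \<le> i" "k \<in> ?sizes" for i k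
      using that assumption2(6) \<pi> by auto
    show "0 < ?\<pi> k" if "k \<in> ?sizes" for k
      using that assumption2(7) \<pi> by auto
    show "2 \<le> k" if "k \<in> ?sizes" for k
      using that assumption2(4) by auto
  qed (fact | simp)+
  obtain s where s: "s \<in> {1..c}" "gcd (m s - 1) d = 1" using assumption2(9) by (rule bexE)
  \<comment> \<open>Since \<open>m s\<close> is at least 2, the subtraction on natural numbers is
    not truncated.\<close>
  have "Suc (m s - 1) = m s" using assumption2(4)[OF s(1)] by simp
  then have "Suc (m s - 1) \<in> ?sizes" using s(1) by simp
  moreover have "coprime (m s - 1) (order G)"
    using s(2) \<open>order G = d\<close> by (simp add: coprime_iff_gcd_eq_1)
  ultimately have "AE \<omega> in P. \<forall>h\<in>carrier G. (\<lambda>n. urn.share n \<omega> h) \<longlonglongrightarrow> 1 / real (order G)"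
    by (rule urn.AE_share_tendsto)
  moreover have "g j \<in> carrier G"
    using \<open>bij_betw g {..<d} (carrier G)\<close> \<open>j < d\<close> by (auto dest: bij_betwE)
  ultimately show ?thesis
    using \<open>order G = d\<close> by (auto simp: urn.share_def)
qed

end
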